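(* Let $\mathfrak{g}$ be the N=1 Heisenberg-Virasoro superalgebra and $\mathfrak{h}=\mathbb{C}L_0\oplus\mathbb{C}H_0\subseteq\mathfrak{g}$. Let $M$ be a $\mathfrak{g}$-module such that the restriction of $M$ to $U(\mathfrak{h})$ is free of rank $2$. Then, up to parity (i.e. for $M$ or for its parity change $\Pi(M)$ in place of $M$), we have $M\cong\Omega(\lambda,\beta)$ as $\mathfrak{g}$-modules for some $\lambda\in\mathbb{C}^*$ and some polynomial $\beta(y)\in\mathbb{C}[y]$.
   Context: All vector spaces are over $\mathbb{C}$; all modules over Lie superalgebras are $\mathbb{Z}_2$-graded. $\mathbb{C}^*$ is the set of nonzero complex numbers. $\Pi$ denotes the parity-change functor, which exchanges the even and odd parts of a module. $U(\mathfrak{h})$ is the universal enveloping algebra; since $L_0,H_0$ commute, $U(\mathfrak{h})=\mathbb{C}[L_0,H_0]$. The N=1 Heisenberg-Virasoro superalgebra $\mathfrak{g}$ is the Lie superalgebra with basis $L_m,H_m,C_1,C_2,C_3$ (even, $m\in\mathbb{Z}$) and $G_p,Q_p$ (odd, $p\in\mathbb{Z}+\frac12$), and brackets, for $m,n\in\mathbb{Z}$, $p,q\in\mathbb{Z}+\frac12$, $[L_m,L_n]=(m-n)L_{m+n}+\delta_{m+n,0}\frac{m^3-m}{12}C_1$, $[L_m,H_n]=-nH_{m+n}+\delta_{m+n,0}(m^2+m)C_2$, $[H_m,H_n]=m\delta_{m+n,0}C_3$, $[L_m,G_p]=(\frac m2-p)G_{m+p}$, $[L_m,Q_p]=-(\frac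 m2+p)Q_{m+p}$, $[H_m,G_p]=mQ_{m+p}$, $[G_p,G_q]=2L_{p+q}+\delta_{p+q,0}\frac{4p^2-1}{12}C_1$, $[G_p,Q_q]=H_{p+q}+(2p+1)\delta_{p+q,0}C_2$, $[Q_p,Q_q]=\delta_{p+q,0}C_3$, $[H_m,Q_p]=[\mathfrak{g},C_i]=0$. For $\lambda\in\mathbb{C}^*$ and $\beta(y)\in\mathbb{C}[y]$, $\Omega(\lambda,\beta)$ is the $\mathfrak{g}$-module with even part $\mathbb{C}[x,y]$ and odd part $\mathbb{C}[s,t]$ and actions (where, for a two-variable polynomial $f$, $f(x,y)\in\mathbb{C}[x,y]$ and $f(s,t)\in\mathbb{C}[s,t]$ denote the polynomial in the respective variables; $m\in\mathbb{Z}$, $p\in\mathbb{Z}+\frac12$): $L_mf(x,y)=\lambda^m(x+m\beta(y))f(x+m,y)$, $L_mf(s,t)=\lambda^m(s+m(\beta(t)+\frac12))f(s+m,t)$, $H_mf(x,y)=\lambda^m yf(x+m,y)$, $H_mf(s,t)=\lambda^m tf(s+m,t)$, $G_pf(x,y)=\lambda^{p-\frac12}f(s+p,t)$, $G_pf(s,t)=\lambda^{p+\frac12}(x+2p\beta(y))f(x+p,y)$, $Q_pf(s,t)=\lambda^{p+\frac12}yf(x+p,y)$, $Q_pf(x,y)=0$, and $C_1,C_2,C_3$ act as $0$. *)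

theory Defs
  imports
    Complex_Main
    "HOL-Library.Poly_Mapping"
    "HOL-Library.Product_Plus"
    "HOL-Library.Z2"
    "HOL-Computational_Algebra.Polynomial"
begin

section \<open>Lie superalgebras and their modules\<close>

text \<open>
  A super vector space is a complex vector space on the whole type \<open>'v\<close> together with its family
  of homogeneous components, indexed by the two-element field \<^typ>\<open>bit\<close>: \<open>V 0\<close> is the even
  part and \<open>V 1\<close> the odd part.
\<close>

locale super_space = vector_space scale
  for scale :: "complex \<Rightarrow> 'v::ab_group_add \<Rightarrow> 'v" +
  fixes V :: "bit \<Rightarrow> 'v set"
  assumes subspace_grade: "subspace (V i)"
    and grade_disjoint: "V 0 \<inter> V 1 = {0}"
    and grade_span: "\<exists>a\<in>V 0. \<exists>b\<in>V 1. v = a + b"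

definition koszul :: "bit \<Rightarrow> bit \<Rightarrow> complex" where
  "koszul i j = (if i = 1 \<and> j = 1 then - 1 else 1)"

locale lie_superalgebra = super_space sc g
  for sc :: "complex \<Rightarrow> 'g::ab_group_add \<Rightarrow> 'g" and g :: "bit \<Rightarrow> 'g set" +
  fixes br :: "'g \<Rightarrow> 'g \<Rightarrow> 'g"
  assumes br_linear_left: "Vector_Spaces.linear sc sc (\<lambda>x. br x y)"
    and br_linear_right: "Vector_Spaces.linear sc sc (\<lambda>y. br x y)"
    and br_grade: "x \<in> g i \<Longrightarrow> y \<in> g j \<Longrightarrow> br x y \<in> g (i + j)"
    and super_skew: "x \<in> g i \<Longrightarrow> y \<in> g j \<Longrightarrow> br x y = - sc (koszul i j) (br y x)"
    and super_jacobi: "x \<in> g i \<Longrightarrow> y \<in> g j \<Longrightarrow>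
      br x (br y z) = br (br x y) z + sc (koszul i j) (br y (br x z))"

locale lie_supermodule = alg: lie_superalgebra sc g br + mdl: super_space scale M
  for sc :: "complex \<Rightarrow> 'g::ab_group_add \<Rightarrow> 'g" and g :: "bit \<Rightarrow> 'g set"
    and br :: "'g \<Rightarrow> 'g \<Rightarrow> 'g"
    and scale :: "complex \<Rightarrow> 'm::ab_group_add \<Rightarrow> 'm" and M :: "bit \<Rightarrow> 'm set" +
  fixes act :: "'g \<Rightarrow> 'm \<Rightarrow> 'm"
  assumes act_linear_left: "Vector_Spaces.linear sc scale (\<lambda>x. act x v)"
    and act_linear_right: "Vector_Spaces.linear scale scale (\<lambda>v. act x v)"
    and act_grade: "x \<in> g i \<Longrightarrow> v \<in> M j \<Longrightarrow> act x v \<in> M (i + j)"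
    and act_bracket: "x \<in> g i \<Longrightarrow> y \<in> g j \<Longrightarrow>
      act (br x y) v = act x (act y v) - scale (koszul i j) (act y (act x v))"

definition parity_change :: "(bit \<Rightarrow> 'm set) \<Rightarrow> bit \<Rightarrow> 'm set" where
  "parity_change M i = M (i + 1)"

text \<open>Isomorphisms of modules are even.\<close>

definition supermodule_iso ::
  "(complex \<Rightarrow> 'm::ab_group_add \<Rightarrow> 'm) \<Rightarrow> (bit \<Rightarrow> 'm set) \<Rightarrow> ('g \<Rightarrow> 'm \<Rightarrow> 'm) \<Rightarrow>
   (complex \<Rightarrow> 'n::ab_group_add \<Rightarrow> 'n) \<Rightarrow> (bit \<Rightarrow> 'n set) \<Rightarrow> ('g \<Rightarrow> 'n \<Rightarrow> 'n) \<Rightarrow> bool" where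
  "supermodule_iso scM M actM scN N actN \<longleftrightarrow>
     (\<exists>\<phi>. Vector_Spaces.linear scM scN \<phi> \<and> bij \<phi> \<and> (\<forall>i. \<phi> ` M i = N i) \<and>
          (\<forall>x v. \<phi> (actM x v) = actN x (\<phi> v)))"

section \<open>The N=1 Heisenberg-Virasoro superalgebra\<close>

text \<open>
  Half-integers \<open>p \<in> \<int> + 1/2\<close> are represented by the integer \<open>p - 1/2\<close>:
  \<open>Gb n\<close> and \<open>Qb n\<close> stand for \<open>G\<^sub>p\<close> and \<open>Q\<^sub>p\<close> with \<open>p = n + 1/2\<close>.
  Hence \<open>p + q\<close> is the integer \<open>n + k + 1\<close> if \<open>p = n + 1/2\<close> and \<open>q = k + 1/2\<close>.
\<close>

datatype hv_basis = Lb int | Hb int | Gb int | Qb int | C1 | C2 | C3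

type_synonym hv = "hv_basis \<Rightarrow>\<^sub>0 complex"

abbreviation half :: "int \<Rightarrow> complex" where
  "half n \<equiv> of_int n + 1 / 2"

definition hv_scale :: "complex \<Rightarrow> hv \<Rightarrow> hv" where
  "hv_scale c x = Poly_Mapping.map ((*) c) x"

fun hv_parity :: "hv_basis \<Rightarrow> bit" where
  "hv_parity (Gb _) = 1"
| "hv_parity (Qb _) = 1"
| "hv_parity _ = 0"

definition hv_grade :: "bit \<Rightarrow> hv set" where
  "hv_grade i = {x. \<forall>b\<in>Poly_Mapping.keys x. hv_parity b = i}"

function (sequential) hv_br :: "hv_basis \<Rightarrow> hv_basis \<Rightarrow> hv" where
  "hv_br (Lb m) (Lb n) = Poly_Mapping.single (Lb (m + n)) (of_int (m - n))
     + Poly_Mapping.single C1 ((of_int m ^ 3 - of_int m) / 12 when m + n = 0)"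
| "hv_br (Lb m) (Hb n) = Poly_Mapping.single (Hb (m + n)) (- of_int n)
     + Poly_Mapping.single C2 (of_int m ^ 2 + of_int m when m + n = 0)"
| "hv_br (Hb n) (Lb m) = - hv_br (Lb m) (Hb n)"
| "hv_br (Hb m) (Hb n) = Poly_Mapping.single C3 (of_int m when m + n = 0)"
| "hv_br (Lb m) (Gb n) = Poly_Mapping.single (Gb (m + n)) (of_int m / 2 - half n)"
| "hv_br (Gb n) (Lb m) = - hv_br (Lb m) (Gb n)"
| "hv_br (Lb m) (Qb n) = Poly_Mapping.single (Qb (m + n)) (- (of_int m / 2 + half n))"
| "hv_br (Qb n) (Lb m) = - hv_br (Lb m) (Qb n)"
| "hv_br (Hb m) (Gb n) = Poly_Mapping.single (Qb (m + n)) (of_int m)"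
| "hv_br (Gb n) (Hb m) = - hv_br (Hb m) (Gb n)"
| "hv_br (Gb n) (Gb k) = Poly_Mapping.single (Lb (n + k + 1)) 2
     + Poly_Mapping.single C1 ((4 * half n ^ 2 - 1) / 12 when n + k + 1 = 0)"
| "hv_br (Gb n) (Qb k) = Poly_Mapping.single (Hb (n + k + 1)) 1
     + Poly_Mapping.single C2 (2 * half n + 1 when n + k + 1 = 0)"
| "hv_br (Qb k) (Gb n) = hv_br (Gb n) (Qb k)"
| "hv_br (Qb n) (Qb k) = Poly_Mapping.single C3 (1 when n + k + 1 = 0)"
| "hv_br _ _ = 0"
  by pat_completeness auto
termination
  by (relation "measure (\<lambda>p. case p of
      (Hb _, Lb _) \<Rightarrow> 1 | (Gb _, Lb _) \<Rightarrow> 1 | (Qb _, Lb _) \<Rightarrow> 1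
    | (Gb _, Hb _) \<Rightarrow> 1 | (Qb _, Gb _) \<Rightarrow> 1 | _ \<Rightarrow> 0)") auto

text \<open>The linear extension of a map given on the basis.\<close>

definition lin_ext :: "(complex \<Rightarrow> 'v::ab_group_add \<Rightarrow> 'v) \<Rightarrow> (hv_basis \<Rightarrow> 'v) \<Rightarrow> hv \<Rightarrow> 'v" where
  "lin_ext sc f x = (\<Sum>b\<in>Poly_Mapping.keys x. sc (Poly_Mapping.lookup x b) (f b))"

definition hv_bracket :: "hv \<Rightarrow> hv \<Rightarrow> hv" where
  "hv_bracket x y = lin_ext hv_scale (\<lambda>a. lin_ext hv_scale (hv_br a) y) x"

abbreviation hv_elt :: "hv_basis \<Rightarrow> hv" where
  "hv_elt b \<equiv> Poly_Mapping.single b 1"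

abbreviation hv_module ::
  "(complex \<Rightarrow> 'm::ab_group_add \<Rightarrow> 'm) \<Rightarrow> (bit \<Rightarrow> 'm set) \<Rightarrow> (hv \<Rightarrow> 'm \<Rightarrow> 'm) \<Rightarrow> bool" where
  "hv_module \<equiv> lie_supermodule hv_scale hv_grade hv_bracket"

section \<open>Restriction to the enveloping algebra of \<open>\<hh> = \<complex>L\<^sub>0 \<oplus> \<complex>H\<^sub>0\<close>\<close>

text \<open>The action of \<open>R[T]\<close> on an \<open>R\<close>-module in which \<open>T\<close> acts by the endomorphism \<open>A\<close>.\<close>

definition poly_act ::
  "('a::comm_ring_1 \<Rightarrow> 'm::ab_group_add \<Rightarrow> 'm) \<Rightarrow> ('m \<Rightarrow> 'm) \<Rightarrow> 'a poly \<Rightarrow> 'm \<Rightarrow> 'm" where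
  "poly_act scale A p v = (\<Sum>i\<le>degree p. scale (coeff p i) ((A ^^ i) v))"

text \<open>
  \<^typ>\<open>complex poly poly\<close> is \<open>\<complex>[y][x]\<close>, with \<open>x\<close> the outer variable. As \<open>U(\<hh>)\<close> it is
  \<open>\<complex>[H\<^sub>0][L\<^sub>0]\<close>: the outer variable is \<open>L\<^sub>0\<close>, the inner one \<open>H\<^sub>0\<close>.
\<close>

definition Uh_scale ::
  "(complex \<Rightarrow> 'm::ab_group_add \<Rightarrow> 'm) \<Rightarrow> (hv \<Rightarrow> 'm \<Rightarrow> 'm) \<Rightarrow> complex poly poly \<Rightarrow> 'm \<Rightarrow> 'm" where
  "Uh_scale scale act =
     poly_act (poly_act scale (act (hv_elt (Hb 0)))) (act (hv_elt (Lb 0)))"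

text \<open>The basis is not required to be homogeneous.\<close>

definition free_of_rank ::
  "('a::comm_ring_1 \<Rightarrow> 'm::ab_group_add \<Rightarrow> 'm) \<Rightarrow> nat \<Rightarrow> bool" where
  "free_of_rank scale n \<longleftrightarrow> module scale \<and>
     (\<exists>B. finite B \<and> card B = n \<and> \<not> module.dependent scale B \<and> module.span scale B = UNIV)"

section \<open>The modules \<open>\<Omega>(\<lambda>,\<beta>)\<close>\<close>

text \<open>
  A pair \<open>(f, g)\<close> is \<open>f(x,y) + g(s,t)\<close> with \<open>f\<close> in the even and \<open>g\<close> in the odd part. In either
  component the outer variable is \<open>x\<close> (resp. \<open>s\<close>) and the inner one is \<open>y\<close> (resp. \<open>t\<close>).
\<close>

type_synonym omega = "complex poly poly \<times> complex poly poly"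

definition cst :: "complex \<Rightarrow> complex poly poly" where
  "cst c = [:[:c:]:]"

definition var_x :: "complex poly poly" where
  "var_x = [:0, 1:]"

definition in_y :: "complex poly \<Rightarrow> complex poly poly" where
  "in_y q = [:q:]"

text \<open>\<open>shift a f\<close> is \<open>f(x + a, y)\<close>.\<close>

definition shift :: "complex \<Rightarrow> complex poly poly \<Rightarrow> complex poly poly" where
  "shift a f = pcompose f (var_x + cst a)"

definition omega_scale :: "complex \<Rightarrow> omega \<Rightarrow> omega" where
  "omega_scale c v = (cst c * fst v, cst c * snd v)"

definition omega_grade :: "bit \<Rightarrow> omega set" where
  "omega_grade i = (if i = 0 then {v. snd v = 0} else {v. fst v = 0})"

text \<open>With \<open>p = n + 1/2\<close> the exponents are \<open>p - 1/2 = n\<close> and \<open>p + 1/2 = n + 1\<close>.\<close>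

fun omega_gen :: "complex \<Rightarrow> complex poly \<Rightarrow> hv_basis \<Rightarrow> omega \<Rightarrow> omega" where
  "omega_gen l \<beta> (Lb m) (f, g) =
     (cst (l powi m) * (var_x + cst (of_int m) * in_y \<beta>) * shift (of_int m) f,
      cst (l powi m) * (var_x + cst (of_int m) * (in_y \<beta> + cst (1 / 2))) * shift (of_int m) g)"
| "omega_gen l \<beta> (Hb m) (f, g) =
     (cst (l powi m) * in_y [:0, 1:] * shift (of_int m) f,
      cst (l powi m) * in_y [:0, 1:] * shift (of_int m) g)"
| "omega_gen l \<beta> (Gb n) (f, g) =
     (cst (l powi (n + 1)) * (var_x + cst (2 * half n) * in_y \<beta>) * shift (half n) g,
      cst (l powi n) * shift (half n) f)"
| "omega_gen l \<beta> (Qb n) (f, g) =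
     (cst (l powi (n + 1)) * in_y [:0, 1:] * shift (half n) g, 0)"
| "omega_gen l \<beta> _ _ = 0"

definition omega_act :: "complex \<Rightarrow> complex poly \<Rightarrow> hv \<Rightarrow> omega \<Rightarrow> omega" where
  "omega_act l \<beta> x v = lin_ext omega_scale (\<lambda>b. omega_gen l \<beta> b v) x"

section \<open>The bracket defines a Lie superalgebra\<close>

lemma lookup_hv_scale [simp]: "Poly_Mapping.lookup (hv_scale c x) b = c * Poly_Mapping.lookup x b"
  unfolding hv_scale_def by (simp add: Poly_Mapping.map.rep_eq when_def)

interpretation hv_vs: vector_space hv_scale
  by standard (auto intro!: poly_mapping_eqI simp: lookup_add algebra_simps)

lemma hv_scale_single [simp]:
  "hv_scale c (Poly_Mapping.single b d) = Poly_Mapping.single b (c * d)"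
  by (rule poly_mapping_eqI) (simp add: lookup_single when_def)

lemma hv_expand:
  "x = (\<Sum>b\<in>Poly_Mapping.keys x. hv_scale (Poly_Mapping.lookup x b) (hv_elt b))"
  by (rule poly_mapping_eqI)
     (auto simp: lookup_sum lookup_single when_def not_in_keys_iff_lookup_eq_zero if_distrib cong: if_cong)

lemma lin_ext_superset:
  assumes "vector_space sc" "finite A" "Poly_Mapping.keys x \<subseteq> A"
  shows "lin_ext sc f x = (\<Sum>b\<in>A. sc (Poly_Mapping.lookup x b) (f b))"
proof -
  interpret vector_space sc by fact
  show ?thesis unfolding lin_ext_def
    by (rule sum.mono_neutral_left) (use assms in \<open>auto simp: not_in_keys_iff_lookup_eq_zero\<close>)
qed

lemma lin_ext_linear:
  assumes "vector_space sc"
  shows "Vector_Spaces.linear hv_scale sc (lin_ext sc f)"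
proof -
  interpret vector_space sc by fact
  have add: "lin_ext sc f (x + y) = lin_ext sc f x + lin_ext sc f y" for x y
  proof -
    let ?A = "Poly_Mapping.keys x \<union> Poly_Mapping.keys y"
    have "Poly_Mapping.keys (x + y) \<subseteq> ?A" by (rule keys_add)
    then show ?thesis
      by (simp add: lin_ext_superset[OF assms, where A = ?A] lookup_add scale_left_distrib sum.distrib)
  qed
  have sc: "lin_ext sc f (hv_scale c x) = sc c (lin_ext sc f x)" for c x
  proof -
    have "Poly_Mapping.keys (hv_scale c x) \<subseteq> Poly_Mapping.keys x"
      by (auto simp: in_keys_iff)
    then show ?thesis
      by (simp add: lin_ext_superset[OF assms, where A = "Poly_Mapping.keys x"] scale_sum_right)
  qed
  show ?thesis
    by (intro Vector_Spaces.linear.intro module_hom.intro module_hom_axioms.intro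
        hv_vs.vector_space_axioms assms add sc hv_vs.module_axioms module_axioms)
qed

lemma lin_ext_single:
  assumes "vector_space sc"
  shows "lin_ext sc f (Poly_Mapping.single b c) = sc c (f b)"
proof -
  interpret vector_space sc by fact
  show ?thesis by (simp add: lin_ext_def)
qed

lemmas lin_ext_add = module_hom.add[OF Vector_Spaces.linear.axioms(3)[OF lin_ext_linear]]
lemmas lin_ext_scale = module_hom.scale[OF Vector_Spaces.linear.axioms(3)[OF lin_ext_linear]]

lemma lin_ext_fun_add:
  assumes "vector_space sc"
  shows "lin_ext sc (\<lambda>b. f b + g b) x = lin_ext sc f x + lin_ext sc g x"
proof -
  interpret vector_space sc by fact
  show ?thesis by (simp add: lin_ext_def scale_right_distrib sum.distrib)
qed

lemma lin_ext_fun_scale: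
  assumes "vector_space sc"
  shows "lin_ext sc (\<lambda>b. sc c (f b)) x = sc c (lin_ext sc f x)"
proof -
  interpret vector_space sc by fact
  show ?thesis by (simp add: lin_ext_def scale_sum_right mult.commute)
qed

lemma linearI_vector_space:
  assumes "vector_space s1" "vector_space s2"
    "\<And>x y. f (x + y) = f x + f y" "\<And>c x. f (s1 c x) = s2 c (f x)"
  shows "Vector_Spaces.linear s1 s2 f"
  using assms unfolding Vector_Spaces.linear_def module_hom_def module_hom_axioms_def
  by (simp add: module_iff_vector_space)

lemma hv_bracket_add_left: "hv_bracket (x + x') y = hv_bracket x y + hv_bracket x' y"
  and hv_bracket_scale_left: "hv_bracket (hv_scale c x) y = hv_scale c (hv_bracket x y)"
  and hv_bracket_add_right: "hv_bracket x (y + y') = hv_bracket x y + hv_bracket x y'"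
  and hv_bracket_scale_right: "hv_bracket x (hv_scale c y) = hv_scale c (hv_bracket x y)"
  unfolding hv_bracket_def
  by (simp_all add: lin_ext_add[OF hv_vs.vector_space_axioms] lin_ext_scale[OF hv_vs.vector_space_axioms]
      lin_ext_fun_add[OF hv_vs.vector_space_axioms] lin_ext_fun_scale[OF hv_vs.vector_space_axioms]
      del: hv_vs.vector_space_axioms)

lemma hv_bracket_single: 
  "hv_bracket (Poly_Mapping.single a c) (Poly_Mapping.single b d) = hv_scale (c * d) (hv_br a b)"
  unfolding hv_bracket_def by (simp add: lin_ext_single[OF hv_vs.vector_space_axioms])

lemma hv_bracket_zero [simp]: "hv_bracket 0 y = 0" "hv_bracket x 0 = 0"
  using hv_bracket_scale_left[of 0 0 y] hv_bracket_scale_right[of x 0 0] by simp_all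
lemma hv_bracket_minus [simp]: "hv_bracket (-x) y = - hv_bracket x y" "hv_bracket x (-y) = - hv_bracket x y"
  using hv_bracket_scale_left[of "-1" x y] hv_bracket_scale_right[of x "-1" y] by simp_all

lemma hv_grade_subspace: "hv_vs.subspace (hv_grade i)"
proof (rule hv_vs.subspaceI)
  show "0 \<in> hv_grade i" by (simp add: hv_grade_def)
  show "x + y \<in> hv_grade i" if "x \<in> hv_grade i" "y \<in> hv_grade i" for x y
    using that keys_add[of x y] unfolding hv_grade_def by blast
  show "hv_scale c x \<in> hv_grade i" if "x \<in> hv_grade i" for c x
    using that unfolding hv_grade_def by (auto simp: in_keys_iff)
qed

lemma hv_grade_single [simp]: "Poly_Mapping.single b c \<in> hv_grade i \<longleftrightarrow> c = 0 \<or> hv_parity b = i"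
  by (auto simp: hv_grade_def)

lemma hv_grade_induct [consumes 1, case_names zero step]:
  assumes "x \<in> hv_grade i" "P 0"
    and "\<And>b c x. hv_parity b = i \<Longrightarrow> P x \<Longrightarrow> P (hv_scale c (hv_elt b) + x)"
  shows "P x"
proof -
  have "P (\<Sum>b\<in>A. hv_scale (Poly_Mapping.lookup x b) (hv_elt b))"
    if "finite A" "A \<subseteq> Poly_Mapping.keys x" for A
    using that
  proof induction
    case empty then show ?case using assms by simp
  next
    case (insert b A)
    have "hv_parity b = i" using insert assms(1) by (auto simp: hv_grade_def)
    then show ?case using insert assms(3)[of b] by (simp del: hv_scale_single)
  qed
  from this[of "Poly_Mapping.keys x"] show ?thesis using hv_expand[of x] by simp
qed

lemma hv_induct [case_names zero step]:
  assumes "P 0" "\<And>b c x. P x \<Longrightarrow> P (hv_scale c (hv_elt b) + x)"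
  shows "P x"
proof -
  have "P (\<Sum>b\<in>A. hv_scale (Poly_Mapping.lookup x b) (hv_elt b))"
    if "finite A" "A \<subseteq> Poly_Mapping.keys x" for A
    using that assms by induction (auto simp del: hv_scale_single)
  from this[of "Poly_Mapping.keys x"] show ?thesis using hv_expand[of x] by simp
qed

lemma hv_super_space: "super_space hv_scale hv_grade"
proof (unfold_locales, goal_cases)
  case (1 i) show ?case by (rule hv_grade_subspace)
next
  case 2
  have "x = 0" if "x \<in> hv_grade 0" "x \<in> hv_grade 1" for x
  proof -
    have "Poly_Mapping.keys x = {}" using that by (auto simp: hv_grade_def)
    then show ?thesis by simp
  qed
  then show ?case by (auto simp: hv_grade_def)
next
  case (3 v)
  show ?case
  proof (induction v rule: hv_induct)
    case zero show ?case by (rule bexI[of _ 0], rule bexI[of _ 0]) (auto simp: hv_grade_def)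
  next
    case (step b c x)
    then obtain u w where u: "u \<in> hv_grade 0" and w: "w \<in> hv_grade 1" and x: "x = u + w" by blast
    have s: "hv_scale c (hv_elt b) \<in> hv_grade (hv_parity b)" by simp
    show ?case
    proof (cases "hv_parity b = 0")
      case True
      then have "hv_scale c (hv_elt b) + u \<in> hv_grade 0"
        using s u hv_vs.subspace_add[OF hv_grade_subspace] by metis
      with w x show ?thesis by (metis add.assoc)
    next
      case False
      then have "hv_parity b = 1" by simp
      then have "hv_scale c (hv_elt b) + w \<in> hv_grade 1"
        using s w hv_vs.subspace_add[OF hv_grade_subspace] by metis
      with u x show ?thesis by (metis add.left_commute)
    qed
  qed
qed

lemma hv_br_grade: "hv_br a b \<in> hv_grade (hv_parity a + hv_parity b)"
  by (induction a b rule: hv_br.induct)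
     (auto intro!: hv_vs.subspace_add[OF hv_grade_subspace] hv_vs.subspace_diff[OF hv_grade_subspace] hv_vs.subspace_neg[OF hv_grade_subspace] hv_vs.subspace_0[OF hv_grade_subspace] simp: add.commute)


lemma int_sum4_one_eq_0: "x + (y + (z + 1)) = (0::int) \<Longrightarrow> z = - 1 - x - y" by simp
lemma int_sum3_one_eq_0: "x + (y + 1) = (0::int) \<Longrightarrow> y = - 1 - x" by simp
lemma int_sum4_eq_0: "x + (y + (z + w)) = (0::int) \<Longrightarrow> w = - x - y - z" by simp
lemma int_sum3_eq_0: "x + (y + z) = (0::int) \<Longrightarrow> z = - x - y" by simp
lemma int_sum2_eq_0: "x + y = (0::int) \<Longrightarrow> y = - x" by simp
lemma hv_bracket_diff: "hv_bracket (x - x') y = hv_bracket x y - hv_bracket x' y"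
  "hv_bracket x (y - y') = hv_bracket x y - hv_bracket x y'"
  using hv_bracket_add_left[of x "-x'" y] hv_bracket_add_right[of x y "-y'"] by simp_all


lemma hv_br_skew: "hv_br a b = - hv_scale (koszul (hv_parity a) (hv_parity b)) (hv_br b a)"
  apply (cases a; cases b; simp add: koszul_def; 
    (rule poly_mapping_eqI; simp add: lookup_add lookup_minus lookup_single when_def add_ac)?;
     (intro conjI impI)?;
     ((drule int_sum4_one_eq_0 | drule int_sum3_one_eq_0 | drule int_sum4_eq_0 | drule int_sum3_eq_0 | drule int_sum2_eq_0), hypsubst)?; (simp add: power2_eq_square power3_eq_cube field_simps; fail)?)
  done

lemma hv_br_jacobi: "hv_bracket (hv_elt a) (hv_br b c) = hv_bracket (hv_br a b) (hv_elt c)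
   + hv_scale (koszul (hv_parity a) (hv_parity b)) (hv_bracket (hv_elt b) (hv_br a c))"
  apply (cases a; cases b; cases c; simp add: koszul_def hv_bracket_add_left hv_bracket_add_right hv_bracket_single hv_vs.scale_right_distrib hv_vs.scale_right_diff_distrib hv_bracket_diff;
    (rule poly_mapping_eqI; simp add: lookup_add lookup_minus lookup_single when_def add_ac)?;
     (intro conjI impI)?;
     ((drule int_sum4_one_eq_0 | drule int_sum3_one_eq_0 | drule int_sum4_eq_0 | drule int_sum3_eq_0 | drule int_sum2_eq_0), hypsubst)?; (simp add: power2_eq_square power3_eq_cube field_simps; fail)?)
  done

lemma hv_lie_superalgebra: "lie_superalgebra hv_scale hv_grade hv_bracket"
proof (intro lie_superalgebra.intro hv_super_space lie_superalgebra_axioms.intro)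
  show "Vector_Spaces.linear hv_scale hv_scale (\<lambda>x. hv_bracket x y)" for y
    by (intro linearI_vector_space hv_vs.vector_space_axioms hv_bracket_add_left hv_bracket_scale_left)
  show "Vector_Spaces.linear hv_scale hv_scale (\<lambda>y. hv_bracket x y)" for x
    by (intro linearI_vector_space hv_vs.vector_space_axioms hv_bracket_add_right hv_bracket_scale_right)
next
  fix x y i j assume x: "x \<in> hv_grade i" and y: "y \<in> hv_grade j"
  have 1: "hv_bracket (hv_elt b) y \<in> hv_grade (hv_parity b + j)" for b
    using y
  proof (induction rule: hv_grade_induct)
    case (step d c x)
    then show ?case using hv_br_grade[of b d]
      by (auto simp: hv_bracket_add_right hv_bracket_single
          intro!: hv_vs.subspace_add[OF hv_grade_subspace] hv_vs.subspace_scale[OF hv_grade_subspace])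
  qed (simp add: hv_vs.subspace_0[OF hv_grade_subspace])
  show "hv_bracket x y \<in> hv_grade (i + j)"
    using x
  proof (induction rule: hv_grade_induct)
    case (step d c x)
    then show ?case using 1[of d]
      by (auto simp: hv_bracket_add_left hv_bracket_scale_left simp del: hv_scale_single
          intro!: hv_vs.subspace_add[OF hv_grade_subspace] hv_vs.subspace_scale[OF hv_grade_subspace])
  qed (simp add: hv_vs.subspace_0[OF hv_grade_subspace])
next
  fix x y i j assume x: "x \<in> hv_grade i" and y: "y \<in> hv_grade j"
  have 1: "hv_bracket (hv_elt b) y = - hv_scale (koszul (hv_parity b) j) (hv_bracket y (hv_elt b))" for b
    using y
  proof (induction rule: hv_grade_induct)
    case (step d c x)
    have "hv_bracket (hv_elt b) (hv_elt d)
        = - hv_scale (koszul (hv_parity b) j) (hv_bracket (hv_elt d) (hv_elt b))"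
      using hv_br_skew[of b d] step by (simp add: hv_bracket_single)
    then show ?case using step
      by (simp add: hv_bracket_add_left hv_bracket_add_right hv_bracket_scale_left hv_bracket_scale_right
          hv_vs.scale_right_distrib mult.commute del: hv_scale_single)
  qed simp
  show "hv_bracket x y = - hv_scale (koszul i j) (hv_bracket y x)"
    using x
  proof (induction rule: hv_grade_induct)
    case (step d c x)
    then show ?case using 1[of d]
      by (simp add: hv_bracket_add_left hv_bracket_add_right hv_bracket_scale_left hv_bracket_scale_right
          hv_vs.scale_right_distrib mult.commute del: hv_scale_single)
  qed simp
next
  note simps = hv_bracket_add_left hv_bracket_add_right hv_bracket_scale_left hv_bracket_scale_right
          hv_vs.scale_right_distrib mult.commute
  fix x y z i j assume x: "x \<in> hv_grade i" and y: "y \<in> hv_grade j"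
  have 1: "hv_bracket (hv_elt a) (hv_bracket (hv_elt b) z) = hv_bracket (hv_bracket (hv_elt a) (hv_elt b)) z
      + hv_scale (koszul (hv_parity a) (hv_parity b)) (hv_bracket (hv_elt b) (hv_bracket (hv_elt a) z))" for a b
  proof (induction z rule: hv_induct)
    case (step d c z)
    have "hv_bracket (hv_elt a) (hv_bracket (hv_elt b) (hv_elt d)) = hv_bracket (hv_bracket (hv_elt a) (hv_elt b)) (hv_elt d)
      + hv_scale (koszul (hv_parity a) (hv_parity b)) (hv_bracket (hv_elt b) (hv_bracket (hv_elt a) (hv_elt d)))"
      using hv_br_jacobi[of a b d] by (simp add: hv_bracket_single)
    then show ?case using step by (simp add: simps del: hv_scale_single)
  qed simp
  have 2: "hv_bracket (hv_elt a) (hv_bracket y z) = hv_bracket (hv_bracket (hv_elt a) y) z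
      + hv_scale (koszul (hv_parity a) j) (hv_bracket y (hv_bracket (hv_elt a) z))" for a
    using y
  proof (induction rule: hv_grade_induct)
    case (step d c y)
    then show ?case using 1[of a d] by (simp add: simps del: hv_scale_single)
  qed simp
  show "hv_bracket x (hv_bracket y z) = hv_bracket (hv_bracket x y) z
      + hv_scale (koszul i j) (hv_bracket y (hv_bracket x z))"
    using x
  proof (induction rule: hv_grade_induct)
    case (step d c x)
    then show ?case using 2[of d] by (simp add: simps del: hv_scale_single)
  qed simp
qed

section \<open>\<open>\<Omega>(\<lambda>,\<beta>)\<close> is a module\<close>


lemma cst_simps: "cst (a + b) = cst a + cst b" "cst (a - b) = cst a - cst b" "cst (- a) = - cst a"
  "cst (a * b) = cst a * cst b" "cst 0 = 0" "cst 1 = 1" 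
  by (simp_all add: cst_def one_pCons)
lemma cst_num: "cst (numeral n) = numeral n"
  by (simp add: cst_def numeral_poly)
definition hcst :: "complex poly poly" where
  "hcst = cst (1 / 2)"

lemma cst_div2: "cst (a / 2) = cst a * hcst"
  by (simp add: cst_def hcst_def)
lemma cst_half: "2 * hcst = 1"
  using cst_simps(4)[of 2 "1/2"] by (simp add: cst_simps cst_num hcst_def)
interpretation omega_vs: vector_space omega_scale
  by standard (simp_all add: omega_scale_def algebra_simps cst_simps)

lemma omega_vector_space: "vector_space omega_scale" ..

lemma shift_simps [simp]: "shift a (p + q) = shift a p + shift a q" "shift a (p * q) = shift a p * shift a q"
  "shift a 0 = 0" "shift a (in_y r) = in_y r" "shift a (cst c) = cst c" "shift a var_x = var_x + cst a"
  by (simp_all add: shift_def pcompose_add pcompose_mult pcompose_pCons cst_def in_y_def var_x_def)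

lemma shift_shift [simp]: "shift a (shift b p) = shift (a + b) p"
proof -
  have "pcompose (var_x + cst b) (var_x + cst a) = var_x + cst (a + b)"
  proof -
    have "pcompose (var_x + cst b) (var_x + cst a) = shift a (var_x + cst b)" by (simp only: shift_def)
    then show ?thesis by (simp add: cst_simps add_ac)
  qed
  then show ?thesis unfolding shift_def by (simp add: pcompose_assoc[symmetric])
qed

lemma omega_gen_add: "omega_gen l \<beta> b (v + w) = omega_gen l \<beta> b v + omega_gen l \<beta> b w"
  by (cases v; cases w; cases b) (simp_all add: algebra_simps zero_prod_def)

lemma omega_gen_scale: "omega_gen l \<beta> b (omega_scale c v) = omega_scale c (omega_gen l \<beta> b v)"
  by (cases v; cases b) (simp_all add: omega_scale_def zero_prod_def algebra_simps)

lemma omega_act_linear_left: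
   "omega_act l \<beta> (x + y) v = omega_act l \<beta> x v + omega_act l \<beta> y v"
   "omega_act l \<beta> (hv_scale c x) v = omega_scale c (omega_act l \<beta> x v)"
  unfolding omega_act_def by (rule lin_ext_add[OF omega_vector_space] lin_ext_scale[OF omega_vector_space])+
lemma omega_act_minus:
   "omega_act l \<beta> (- x) v = - omega_act l \<beta> x v"
   "omega_act l \<beta> (x - y) v = omega_act l \<beta> x v - omega_act l \<beta> y v"
  "omega_act l \<beta> 0 v = 0"
proof -
  show 1: "omega_act l \<beta> (- x) v = - omega_act l \<beta> x v" for x
   using omega_act_linear_left(2)[of l \<beta> "-1" x v] by simp
  show "omega_act l \<beta> (x - y) v = omega_act l \<beta> x v - omega_act l \<beta> y v"
    using omega_act_linear_left(1)[of l \<beta> x "-y"] 1 by simp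
  show  "omega_act l \<beta> 0 v = 0" by (simp add: omega_act_def lin_ext_def)
qed
lemma omega_act_single: "omega_act l \<beta> (Poly_Mapping.single b c) v = omega_scale c (omega_gen l \<beta> b v)"
  by (simp add: omega_act_def lin_ext_single[OF omega_vector_space])


lemma ring_aux:
  fixes h :: "'a::idom" assumes h: "2 * h = 1"
  shows "(m * h - (h + n)) * (c * (d * l) * (x + (1 + (2 * m + 2 * n)) * b) * S)
     = c * (x + m * b) * (d * l * (x + (m + (1 + 2 * n) * b)) * S)
     - d * l * (x + (1 + 2 * n) * b) * (c * (h + (x + (n + m * (h + b)))) * S)"
   "- ((m * h - (h + n)) * (d * (c * l) * (x + (1 + (2 * n + 2 * m)) * b) * S))
     = d * l * (x + (1 + 2 * n) * b) * (c * (h + (x + (n + m * (h + b)))) * S)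
     - c * (x + m * b) * (d * l * (x + (m + (1 + 2 * n) * b)) * S)"
   "2 * (c * (d * l) * (x + (1 + (n + k)) * (h + b)) * S)
     = c * (d * l * (h + (x + (n + (1 + 2 * k) * b))) * S)
     + d * (c * l * (h + (x + (k + (1 + 2 * n) * b))) * S)"
  using h by algebra+

lemma omega_gen_zero [simp]: "omega_gen l \<beta> b 0 = 0"
  using omega_gen_add[of l \<beta> b 0 0] by simp

lemma omega_gen_bracket:
  assumes "l \<noteq> 0"
  shows "omega_act l \<beta> (hv_br a b) v = omega_gen l \<beta> a (omega_gen l \<beta> b v)
     - omega_scale (koszul (hv_parity a) (hv_parity b)) (omega_gen l \<beta> b (omega_gen l \<beta> a v))"
  apply (cases v; cases a; cases b; simp add: omega_act_linear_left omega_act_minus omega_act_single koszul_def;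
   (simp only: omega_scale_def fst_conv snd_conv)?; (simp add: zero_prod_def cst_simps cst_num cst_div2 hcst_def[symmetric] power_int_add assms add_ac)?;
   (intro conjI)?; ((rule ring_aux, rule cst_half) | (simp add: algebra_simps;fail))?)
  done

lemma omega_act_linear_right:
   "omega_act l \<beta> x (v + w) = omega_act l \<beta> x v + omega_act l \<beta> x w"
   "omega_act l \<beta> x (omega_scale c v) = omega_scale c (omega_act l \<beta> x v)"
  by (simp_all add: omega_act_def omega_gen_add omega_gen_scale lin_ext_fun_add[OF omega_vector_space]
     lin_ext_fun_scale[OF omega_vector_space])

lemma omega_act_minus_right:
   "omega_act l \<beta> x (- v) = - omega_act l \<beta> x v"
   "omega_act l \<beta> x (v - w) = omega_act l \<beta> x v - omega_act l \<beta> x w"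
  "omega_act l \<beta> x 0 = 0"
proof -
  show 1: "omega_act l \<beta> x (- v) = - omega_act l \<beta> x v" for v
   using omega_act_linear_right(2)[of l \<beta> x "-1" v] by simp
  show "omega_act l \<beta> x (v - w) = omega_act l \<beta> x v - omega_act l \<beta> x w"
    using omega_act_linear_right(1)[of l \<beta> x v "-w"] 1 by simp
  show  "omega_act l \<beta> x 0 = 0" using omega_act_linear_right(2)[of l \<beta> x 0 0] by simp
qed

lemma omega_grade_subspace: "omega_vs.subspace (omega_grade i)"
  by (rule omega_vs.subspaceI) (auto simp: omega_grade_def omega_scale_def split: if_splits)

lemma omega_super_space: "super_space omega_scale omega_grade"
proof (unfold_locales, goal_cases)
  case (1 i) show ?case by (rule omega_grade_subspace)
next
  case 2 show ?case by (auto simp: omega_grade_def prod_eq_iff)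
next
  case (3 v)
  show ?case
    by (rule bexI[of _ "(fst v, 0)"], rule bexI[of _ "(0, snd v)"]) (auto simp: omega_grade_def)
qed

lemma omega_gen_grade: "v \<in> omega_grade j \<Longrightarrow> omega_gen l \<beta> b v \<in> omega_grade (hv_parity b + j)"
  by (cases v; cases b; cases j) (auto simp: omega_grade_def)

lemma omega_hv_module:
  assumes "l \<noteq> 0"
  shows "hv_module omega_scale omega_grade (omega_act l \<beta>)"
proof (intro lie_supermodule.intro hv_lie_superalgebra omega_super_space lie_supermodule_axioms.intro)
  show "Vector_Spaces.linear hv_scale omega_scale (\<lambda>x. omega_act l \<beta> x v)" for v
    by (intro linearI_vector_space hv_vs.vector_space_axioms omega_vector_space omega_act_linear_left)
  show "Vector_Spaces.linear omega_scale omega_scale (\<lambda>v. omega_act l \<beta> x v)" for x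
    by (intro linearI_vector_space omega_vector_space omega_act_linear_right)
next
  fix x v i j assume x: "x \<in> hv_grade i" and v: "v \<in> omega_grade j"
  show "omega_act l \<beta> x v \<in> omega_grade (i + j)"
    using x
  proof (induction rule: hv_grade_induct)
    case (step d c x)
    then show ?case using omega_gen_grade[OF v, of l \<beta> d]
      by (auto simp: omega_act_linear_left omega_act_single
          intro!: omega_vs.subspace_add[OF omega_grade_subspace] omega_vs.subspace_scale[OF omega_grade_subspace])
  qed (simp add: omega_act_minus omega_vs.subspace_0[OF omega_grade_subspace])
next
  note simps = hv_bracket_add_left hv_bracket_add_right hv_bracket_scale_left hv_bracket_scale_right
     omega_act_linear_left omega_act_linear_right omega_vs.scale_right_distrib omega_vs.scale_right_diff_distrib mult.commute
  fix x y v i j assume x: "x \<in> hv_grade i" and y: "y \<in> hv_grade j"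
  have 2: "omega_act l \<beta> (hv_bracket (hv_elt a) y) v = omega_act l \<beta> (hv_elt a) (omega_act l \<beta> y v)
      - omega_scale (koszul (hv_parity a) j) (omega_act l \<beta> y (omega_act l \<beta> (hv_elt a) v))" for a
    using y
  proof (induction rule: hv_grade_induct)
    case (step d c y)
    have "omega_act l \<beta> (hv_bracket (hv_elt a) (hv_elt d)) v = omega_act l \<beta> (hv_elt a) (omega_act l \<beta> (hv_elt d) v)
      - omega_scale (koszul (hv_parity a) j) (omega_act l \<beta> (hv_elt d) (omega_act l \<beta> (hv_elt a) v))"
      using omega_gen_bracket[OF assms, of \<beta> a d v] step by (simp add: hv_bracket_single omega_act_single)
    then show ?case using step by (simp add: simps del: hv_scale_single)
  qed (simp add: omega_act_minus omega_act_minus_right)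
  show "omega_act l \<beta> (hv_bracket x y) v = omega_act l \<beta> x (omega_act l \<beta> y v)
      - omega_scale (koszul i j) (omega_act l \<beta> y (omega_act l \<beta> x v))"
    using x
  proof (induction rule: hv_grade_induct)
    case (step d c x)
    then show ?case using 2[of d] by (simp add: simps del: hv_scale_single)
  qed (simp add: omega_act_minus omega_act_minus_right)
qed

section \<open>The action of \<open>U(\<hh>)\<close> is a module structure\<close>

lemma poly_act_bound:
  assumes "module sc" "degree p \<le> n"
  shows "poly_act sc A p v = (\<Sum>i\<le>n. sc (coeff p i) ((A ^^ i) v))"
proof -
  interpret module sc by fact
  show ?thesis unfolding poly_act_def
    by (rule sum.mono_neutral_left) (use assms in \<open>auto simp: coeff_eq_0\<close>)
qed

lemma module_poly_act:
  assumes hom: "module_hom sc sc A"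
  shows "module (poly_act sc A)"
proof -
  interpret module_hom sc sc A by fact
  have [simp]: "module sc" by (rule m1.module_axioms)
  have pC: "poly_act sc A (pCons a p) v = sc a v + A (poly_act sc A p v)" for a p v
  proof -
    have "poly_act sc A (pCons a p) v = (\<Sum>i\<le>Suc (degree p). sc (coeff (pCons a p) i) ((A ^^ i) v))"
      by (rule poly_act_bound) (auto simp: degree_pCons_le)
    also have "\<dots> = sc a v + A (poly_act sc A p v)"
      by (subst sum.atMost_Suc_shift) (simp add: poly_act_def sum scale)
    finally show ?thesis .
  qed
  have z: "poly_act sc A 0 v = 0" for v by (simp add: poly_act_def)
  have addl: "poly_act sc A (p + q) v = poly_act sc A p v + poly_act sc A q v" for p q v
    by (induction p q rule: poly_induct2) (simp_all add: pC z add m1.scale_left_distrib)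
  have addr: "poly_act sc A p (v + w) = poly_act sc A p v + poly_act sc A p w" for p v w
    by (induction p) (simp_all add: pC z add m1.scale_right_distrib)
  have sm: "poly_act sc A (smult a p) v = sc a (poly_act sc A p v)" for a p v
    by (induction p) (simp_all add: pC z scale m1.scale_right_distrib)
  have mul: "poly_act sc A (p * q) v = poly_act sc A p (poly_act sc A q v)" for p q v
    by (induction p) (simp_all add: pC z addl sm)
  show ?thesis
    by unfold_locales (simp_all add: addl addr mul, simp add: one_pCons pC z)
qed

lemma module_Uh_scale:
  assumes "hv_module scale M act"
  shows "module (Uh_scale scale act)"
proof -
  interpret lie_supermodule hv_scale hv_grade hv_bracket scale M act by fact
  let ?L = "act (hv_elt (Lb 0))" and ?H = "act (hv_elt (Hb 0))"
  have hom: "module_hom scale scale (act x)" for x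
    using act_linear_right[of x] by (rule Vector_Spaces.linear.axioms(3))
  interpret H: module_hom scale scale ?H by (rule hom)
  interpret L: module_hom scale scale ?L by (rule hom)
  have m: "module (poly_act scale ?H)" by (rule module_poly_act[OF hom])
  have br: "hv_bracket (hv_elt (Lb 0)) (hv_elt (Hb 0)) = 0"
    by (simp add: hv_bracket_single)
  have "act 0 v = 0" for v
    using module_hom.zero[OF Vector_Spaces.linear.axioms(3)[OF act_linear_left[of v]]] by simp
  then have comm: "?L (?H v) = ?H (?L v)" for v
    using act_bracket[of "hv_elt (Lb 0)" 0 "hv_elt (Hb 0)" 0 v] br by (simp add: koszul_def)
  have comm': "?L ((?H ^^ i) v) = (?H ^^ i) (?L v)" for i v
    by (induction i) (simp_all add: comm)
  have "module_hom (poly_act scale ?H) (poly_act scale ?H) ?L"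
    unfolding module_hom_def module_hom_axioms_def
    by (simp add: m L.add) (simp add: poly_act_def L.sum L.scale comm')
  then show ?thesis unfolding Uh_scale_def by (rule module_poly_act)
qed

end

theory Submission
  imports Defs
    "HOL-Computational_Algebra.Polynomial_Factorial"
    "HOL-Computational_Algebra.Field_as_Ring"
begin

text \<open>
  Write \<open>x\<close> for \<open>L\<^sub>0\<close> and \<open>y\<close> for \<open>H\<^sub>0\<close>, so that \<open>U(\<hh>) = \<complex>[x,y]\<close>. As \<open>H\<^sub>0\<close> commutes with everything and
  \<open>[L\<^sub>0, b] = - m b\<close> for a basis element \<open>b\<close> of weight \<open>m\<close>, such an element acts semilinearly over the
  translation \<open>f(x,y) \<mapsto> f(x + m,y)\<close> (\<open>gen_smul\<close>). The proof is a comparison of polynomials in \<open>x\<close>.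

  The two parities are direct summands of a free module of rank 2, hence images of complementary idempotent
  matrices. Neither vanishes, since otherwise all odd elements and with them \<open>2 L\<^sub>0\<close> would act by 0. Over the
  factorial ring \<open>\<complex>[x,y]\<close> an idempotent matrix of rank one is a column times a row, so each parity is free on
  one generator, \<open>u\<close> and \<open>w\<close> (\<open>rank_one_parts_exist\<close>).

  Let \<open>G\<^sub>1\<^sub>/\<^sub>2\<close> act by \<open>u \<mapsto> A w\<close>, \<open>w \<mapsto> A' u\<close> and \<open>G\<^sub>-\<^sub>1\<^sub>/\<^sub>2\<close> by \<open>u \<mapsto> B w\<close>, \<open>w \<mapsto> B' u\<close>. Their anticommutator
  \<open>2 L\<^sub>0\<close> forces \<open>B(x + 1/2) A'(x) = x + c(y)\<close> and \<open>A(x - 1/2) B'(x) = x - c(y)\<close> (\<open>G_half_coeffs\<close>). These are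
  irreducible, so in each product one factor is a constant. If \<open>A\<close> and \<open>B\<close>, or \<open>A'\<close> and \<open>B'\<close>, are the
  constants, then up to parity \<open>G\<^sub>1\<^sub>/\<^sub>2\<close> and \<open>G\<^sub>-\<^sub>1\<^sub>/\<^sub>2\<close> act as on \<open>\<Omega>(\<lambda>,\<beta>)\<close> for suitable \<open>\<lambda>\<close> and \<open>\<beta>\<close>
  (\<open>normalisation\<close>).
  The mixed cases would give a representation in which \<open>L\<^sub>1\<close> is quadratic and \<open>L\<^sub>-\<^sub>1\<close> constant, or conversely;
  such representations of the subalgebra generated by \<open>G\<^sub>1\<^sub>/\<^sub>2\<close> and \<open>G\<^sub>-\<^sub>1\<^sub>/\<^sub>2\<close> exist, but \<open>L\<^sub>-\<^sub>2\<close> or \<open>L\<^sub>2\<close> cannot be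
  added to them (\<open>no_quadratic_against_constant\<close>).

  It remains to see that the whole action is then determined. The elements that act as on \<open>\<Omega>(\<lambda>,\<beta>)\<close> form a
  subalgebra containing \<open>L\<^sub>0\<close>, \<open>H\<^sub>0\<close>, \<open>G\<^sub>1\<^sub>/\<^sub>2\<close> and \<open>G\<^sub>-\<^sub>1\<^sub>/\<^sub>2\<close>, hence \<open>L\<^sub>1\<close> and \<open>L\<^sub>-\<^sub>1\<close>. A leading coefficient argument
  (\<open>agree_if_bracket_agrees\<close>) adds \<open>L\<^sub>2\<close>, \<open>L\<^sub>-\<^sub>2\<close> and \<open>H\<^sub>1\<close>, and these generate the rest, including the
  central elements, which therefore act by 0.
\<close>

section \<open>Translation of polynomials in the first variable\<close>

lemma shift_zero [simp]: "shift 0 f = f"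
  by (simp add: shift_def cst_def var_x_def)

lemma shift_one [simp]: "shift a 1 = 1"
  by (simp add: shift_def pcompose_1)

lemma shift_minus [simp]: "shift a (- f) = - shift a f" "shift a (f - g) = shift a f - shift a g"
  by (simp_all add: shift_def pcompose_uminus pcompose_diff)

lemma degree_shift [simp]: "degree (shift a f) = degree f"
  by (simp add: shift_def cst_def var_x_def degree_pcompose)

lemma shift_eq_0_iff [simp]: "shift a f = 0 \<longleftrightarrow> f = 0"
  by (metis add.left_inverse shift_shift shift_simps(3) shift_zero)

lemma shift_eq_cst: "shift a f = cst k \<Longrightarrow> f = cst k"
  by (metis add.left_inverse shift_shift shift_simps(5) shift_zero)

lemma shift_pCons: "shift a (pCons c f) = [:c:] + (var_x + cst a) * shift a f"
  by (simp add: shift_def pcompose_pCons)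

text \<open>
  These are the two leading terms of \<open>(x + a)\<^sup>n\<close>: translation keeps the top coefficient and changes the next
  one by a multiple of it. Differences and commutators lose the first of them, so that the second decides.
\<close>

lemma coeff_shift:
  shows "degree f \<le> n \<Longrightarrow> coeff (shift a f) n = coeff f n"
    and "degree f \<le> Suc n \<Longrightarrow>
      coeff (shift a f) n = coeff f n + of_nat (Suc n) * [:a:] * coeff f (Suc n)"
proof (induction f arbitrary: n)
  case (pCons c f)
  { case 1
    then show ?case
      using pCons.IH(1)[of n] pCons.IH(1)[of "n - 1"]
      by (cases n) (auto simp: shift_pCons var_x_def cst_def coeff_pCons degree_pCons_eq_if coeff_eq_0 split: if_splits)
  next
    case 2
    then show ?case
      using pCons.IH(1)[of n] pCons.IH(2)[of "n - 1"]
      by (cases n) (auto simp: shift_pCons var_x_def cst_def coeff_pCons degree_pCons_eq_if coeff_eq_0 algebra_simps split: if_splits)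
  }
qed simp_all

lemma coeff_mult_top:
  assumes "degree p \<le> i" "degree q \<le> j"
  shows "coeff (p * q) (i + j) = coeff p i * coeff q j"
proof -
  have "coeff (p * q) (i + j) = (\<Sum>k\<le>i + j. coeff p k * coeff q (i + j - k))" by (rule coeff_mult)
  also have "\<dots> = (\<Sum>k\<in>{i}. coeff p k * coeff q (i + j - k))"
  proof (rule sum.mono_neutral_right, goal_cases)
    case 3
    show ?case
    proof
      fix k assume "k \<in> {..i + j} - {i}"
      then have "k > i \<or> i + j - k > j" by auto
      then show "coeff p k * coeff q (i + j - k) = 0" using assms by (auto simp: coeff_eq_0)
    qed
  qed auto
  finally show ?thesis by simp
qed

lemma degree_shift_diff: "degree f \<le> Suc n \<Longrightarrow> degree (shift a f - f) \<le> n"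
  by (rule degree_le) (use coeff_shift(1)[of f] in auto)

lemma coeff_shift_diff:
  "degree f \<le> Suc n \<Longrightarrow> coeff (shift a f - f) n = of_nat (Suc n) * [:a:] * coeff f (Suc n)"
  using coeff_shift(2)[of f n a] by simp

lemma of_nat_mult_const: "of_nat n * [:a::complex:] = [:of_nat n * a:]"
  by (simp add: of_nat_poly)

text \<open>
  The operators \<open>f \<mapsto> d \<cdot> f(x + m)\<close> and \<open>f \<mapsto> P \<cdot> f(x + j)\<close> have the commutator
  \<open>f \<mapsto> (P(x + m) d - d(x + j) P) \<cdot> f(x + m + j)\<close>. The two products cancel in degree \<open>deg P + deg d\<close>; one
  degree lower there remains \<open>m deg P - j deg d\<close> times the product of the leading coefficients.
\<close>

lemma twisted_commutator_coeff:
  assumes P: "degree P = Suc r" and d: "d \<noteq> 0"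
    and ne: "of_nat (Suc r) * m \<noteq> of_nat (degree d) * j"
  shows "coeff (shift m P * d - shift j d * P) (r + degree d) \<noteq> 0"
proof -
  \<comment> \<open>Both differences lose the top degree, so the coefficient of either product is the product
    of two extreme coefficients.\<close>
  have split: "shift m P * d - shift j d * P = (shift m P - P) * d - P * (shift j d - d)"
    by (simp add: algebra_simps)
  have 1: "coeff ((shift m P - P) * d) (r + degree d) = of_nat (Suc r) * [:m:] * lead_coeff P * lead_coeff d"
    using P coeff_mult_top[OF degree_shift_diff[of P r m] order.refl, of d] coeff_shift_diff[of P r m] by simp
  have 2: "coeff (P * (shift j d - d)) (r + degree d) = of_nat (degree d) * [:j:] * lead_coeff P * lead_coeff d"
  proof (cases "degree d")
    case 0
    then obtain c where "d = [:c:]" by (metis degree_0_id)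
    then show ?thesis using 0 by (simp add: shift_pCons)
  next
    case (Suc n)
    then show ?thesis
      using P coeff_mult_top[OF _ degree_shift_diff[of d n j], of P "Suc r"] coeff_shift_diff[of d n j]
      by (simp add: mult_ac)
  qed
  have "coeff (shift m P * d - shift j d * P) (r + degree d)
      = [:of_nat (Suc r) * m - of_nat (degree d) * j:] * lead_coeff P * lead_coeff d"
    unfolding split coeff_diff 1 2 of_nat_mult_const by (simp add: smult_diff_left right_diff_distrib mult_ac)
  moreover have "P \<noteq> 0" using P by auto
  then have "lead_coeff P \<noteq> 0" by simp
  ultimately show ?thesis using d ne by simp
qed

text \<open>
  An operator of weight \<open>m\<close> is determined by its commutator with a linear one of weight \<open>n\<close>: the difference of
  two solutions has commutator zero, and the remaining coefficient \<open>m - n deg\<close> forbids this.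
\<close>

lemma twisted_commutator_unique:
  assumes "degree P = 1" "shift m P * a - shift n a * P = shift m P * a' - shift n a' * P"
    and "\<And>i::nat. m \<noteq> of_nat i * n"
  shows "a = a'"
proof (rule ccontr)
  assume "a \<noteq> a'"
  then have "coeff (shift m P * (a - a') - shift n (a - a') * P) (0 + degree (a - a')) \<noteq> 0"
    using assms(1,3) by (intro twisted_commutator_coeff) auto
  moreover have "shift m P * (a - a') - shift n (a - a') * P = 0"
    using assms(2) by (simp add: algebra_simps)
  ultimately show False by simp
qed

section \<open>Factorisation in \<open>\<complex>[y][x]\<close>\<close>

text \<open>
  A polynomial of degree \<open>n\<close> in \<open>x\<close> has a difference of degree \<open>n - 1\<close>, with leading coefficient multiplied
  by \<open>n\<close>; hence \<open>n = 1\<close> and the leading coefficient is 1.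
\<close>

lemma unit_difference_linear:
  assumes "F - shift (-1) F = 1"
  obtains c where "F = var_x + in_y c"
proof (cases "degree F")
  case 0
  then obtain c where "F = [:c:]" by (metis degree_0_id)
  then show ?thesis using assms by (simp add: shift_pCons)
next
  case (Suc n)
  have "coeff (shift (-1) F) n = coeff F n + [:- of_nat (Suc n):] * lead_coeff F"
    using coeff_shift(2)[of F n "-1"] Suc unfolding of_nat_mult_const by (simp del: of_nat_Suc)
  then have *: "coeff (F - shift (-1) F) n = of_nat (Suc n) * lead_coeff F"
    unfolding coeff_diff of_nat_poly by (simp del: of_nat_Suc)
  have "F \<noteq> 0" using Suc by auto
  then have "lead_coeff F \<noteq> 0" by simp
  then have n: "n = 0" using * assms by (cases n) (auto simp del: of_nat_Suc)
  obtain c G where F: "F = pCons c G" by (cases F)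
  then have "degree G = 0" using Suc n by (simp split: if_splits)
  then obtain b where "F = [:c, b:]" using F by (metis degree_0_id)
  moreover have "b = 1" using * \<open>F = [:c, b:]\<close> n Suc unfolding assms by simp
  ultimately show ?thesis by (intro that[of c]) (simp add: var_x_def in_y_def)
qed

text \<open>
  One factor has degree 0 in \<open>x\<close>. Its leading coefficient divides 1 in \<open>\<complex>[y]\<close>, so it is a constant.
\<close>

lemma monic_linear_factor:
  assumes "p * q = var_x + in_y c"
  shows "\<exists>k. k \<noteq> 0 \<and> (p = cst k \<or> q = cst k)"
proof -
  have deg: "degree p + degree q = 1"
  proof -
    have "degree (p * q) = 1" unfolding assms by (simp add: var_x_def in_y_def)
    moreover from this have "p \<noteq> 0" "q \<noteq> 0" by auto
    ultimately show ?thesis by (simp add: degree_mult_eq)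
  qed
  have lc: "lead_coeff p * lead_coeff q = 1"
    using assms lead_coeff_mult[of p q] by (simp add: var_x_def in_y_def)
  have *: "\<exists>k. k \<noteq> 0 \<and> r = cst k" if "degree r = 0" "lead_coeff r dvd 1" for r
  proof -
    obtain a where r: "r = [:a:]" using \<open>degree r = 0\<close> by (metis degree_0_id)
    with that have "a dvd 1" by simp
    then obtain k where "a = [:k:]" "k \<noteq> 0" by (metis is_unit_poly_iff is_unit_pCons_iff)
    then show ?thesis using r by (auto simp: cst_def)
  qed
  have "degree p = 0 \<or> degree q = 0" using deg by linarith
  moreover have "lead_coeff p dvd 1" "lead_coeff q dvd 1" using lc by (metis dvd_triv_left dvd_triv_right)+
  ultimately show ?thesis using * by metis
qed

lemma degree_linear_factor:
  assumes "cst k * p = var_x + in_y c"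
  shows "degree p = 1"
proof -
  have k: "cst k \<noteq> 0" using assms by (auto simp: var_x_def in_y_def)
  then have "p \<noteq> 0" using assms by (auto simp: var_x_def in_y_def)
  then have "degree p = degree (cst k * p)" using k by (simp add: degree_mult_eq cst_def)
  then show ?thesis by (simp add: assms var_x_def in_y_def)
qed

text \<open>
  A singular \<open>2\<times>2\<close> matrix over a factorial ring is a column times a row: the column is the first column
  of the matrix, if nonzero, divided by the gcd of its entries. For modules of rank one this replaces the theorem that projective modules over
  \<open>\<complex>[x,y]\<close> are free.
\<close>

lemma rank_one_factorization:
  fixes a b c d :: "'a::factorial_ring_gcd"
  assumes "a * d = b * c"
  obtains u1 u2 v1 v2 where "a = u1 * v1" "b = u1 * v2" "c = u2 * v1" "d = u2 * v2"
proof (cases "a = 0 \<and> c = 0")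
  case True
  show ?thesis
    using that[of b 0 1 d] True by (metis mult.right_neutral mult_zero_right)
next
  case False
  then obtain u1 u2 where u: "a = u1 * gcd a c" "c = u2 * gcd a c" "coprime u1 u2"
    using gcd_coprime_exists[of a c] by auto
  have g: "gcd a c \<noteq> 0" using False by simp
  have eq: "u1 * d = b * u2"
  proof -
    have "gcd a c * (u1 * d) = gcd a c * (b * u2)"
      using assms u(1,2) by (metis mult.assoc mult.commute)
    then show ?thesis using g mult_left_cancel by blast
  qed
  then have "u1 dvd b" using u(3) by (metis coprime_dvd_mult_left_iff dvd_triv_left)
  then obtain v2 where v2: "b = u1 * v2" ..
  show ?thesis
  proof (cases "u1 = 0")
    case True
    then have "is_unit u2" using u(3) by simp
    then obtain w where "d = u2 * w" by (metis unit_imp_dvd dvd_def)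
    then show ?thesis using that[of u1 "gcd a c" w u2] u True v2 by simp
  next
    case False
    then have "d = u2 * v2" using eq v2 by (simp add: mult_ac)
    then show ?thesis using that u v2 by blast
  qed
qed

text \<open>
  Reduces statements about the action of \<open>\<complex>[L\<^sub>0,H\<^sub>0]\<close> to scalars, \<open>L\<^sub>0\<close> and \<open>H\<^sub>0\<close>.
\<close>

lemma bivariate_induct [case_names cst add x y]:
  assumes cst: "\<And>c. P (cst c)" and add: "\<And>f g. P f \<Longrightarrow> P g \<Longrightarrow> P (f + g)"
    and x: "\<And>f. P f \<Longrightarrow> P (var_x * f)" and y: "\<And>f. P f \<Longrightarrow> P (in_y [:0, 1:] * f)"
  shows "P f"
proof -
  have q: "P (in_y q)" for q
  proof (induction q)
    case 0 show ?case using cst[of 0] by (simp add: in_y_def cst_def)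
  next
    case (pCons c q)
    have "in_y (pCons c q) = cst c + in_y [:0, 1:] * in_y q" by (simp add: in_y_def cst_def)
    then show ?case using cst add y pCons by metis
  qed
  show ?thesis
  proof (induction f)
    case 0 show ?case using cst[of 0] by (simp add: cst_def)
  next
    case (pCons c f)
    have "pCons c f = in_y c + var_x * f" by (simp add: in_y_def var_x_def)
    then show ?case using q add x pCons by metis
  qed
qed

section \<open>The action of \<open>U(\<hh>)\<close> on a supermodule\<close>

text \<open>
  The number \<open>m\<close> with \<open>[L\<^sub>0, b] = - m b\<close>.
\<close>

fun weight :: "hv_basis \<Rightarrow> complex" where
  "weight (Lb m) = of_int m"
| "weight (Hb m) = of_int m"
| "weight (Gb n) = half n"
| "weight (Qb n) = half n"
| "weight _ = 0"

lemma hv_br_L0: "hv_br (Lb 0) b = hv_scale (- weight b) (hv_elt b)"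
  by (cases b) (auto simp: when_def)

lemma hv_br_H0: "hv_br (Hb 0) b = 0"
  by (cases b) (auto simp: when_def)

locale hv_supermodule =
  lie_supermodule hv_scale hv_grade hv_bracket scale M act
  for scale :: "complex \<Rightarrow> 'm::ab_group_add \<Rightarrow> 'm" and M :: "bit \<Rightarrow> 'm set"
    and act :: "hv \<Rightarrow> 'm \<Rightarrow> 'm"
begin

abbreviation gen :: "hv_basis \<Rightarrow> 'm \<Rightarrow> 'm" where
  "gen b \<equiv> act (hv_elt b)"

abbreviation smul :: "complex poly poly \<Rightarrow> 'm \<Rightarrow> 'm" (infixr "\<bullet>" 75) where
  "smul \<equiv> Uh_scale scale act"

sublocale U: module smul
  by (rule module_Uh_scale) (rule lie_supermodule_axioms)

sublocale act_left: module_hom hv_scale scale "\<lambda>x. act x v" for v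
  using act_linear_left[of v] by (rule Vector_Spaces.linear.axioms(3))

sublocale act_right: module_hom scale scale "act x" for x
  using act_linear_right[of x] by (rule Vector_Spaces.linear.axioms(3))

lemma act_single: "act (Poly_Mapping.single b c) v = scale c (gen b v)"
  using act_left.scale[of c "hv_elt b" v] by simp

lemma gen_bracket:
  "act (hv_br a b) v = gen a (gen b v) - scale (koszul (hv_parity a) (hv_parity b)) (gen b (gen a v))"
  using act_bracket[of "hv_elt a" "hv_parity a" "hv_elt b" "hv_parity b" v]
  by (simp add: hv_bracket_single)

lemma smul_cst: "cst c \<bullet> v = scale c v"
  by (simp add: Uh_scale_def poly_act_def cst_def)

lemma smul_var_x: "var_x \<bullet> v = gen (Lb 0) v"
  by (simp add: Uh_scale_def poly_act_def var_x_def)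

lemma smul_var_y: "in_y [:0, 1:] \<bullet> v = gen (Hb 0) v"
  by (simp add: Uh_scale_def poly_act_def in_y_def)

lemma gen_grade: "v \<in> M j \<Longrightarrow> gen b v \<in> M (hv_parity b + j)"
  by (rule act_grade) auto

lemma smul_grade: "v \<in> M j \<Longrightarrow> f \<bullet> v \<in> M j"
proof (induction f rule: bivariate_induct)
  case (cst c) then show ?case by (simp add: smul_cst mdl.subspace_scale mdl.subspace_grade)
next
  case (add f g) then show ?case by (simp add: U.scale_left_distrib mdl.subspace_add mdl.subspace_grade)
next
  case (x f) then show ?case
    using gen_grade[of "f \<bullet> v" j "Lb 0"]
    by (simp only: smul_var_x hv_parity.simps add_0 flip: U.scale_scale)
next
  case (y f) then show ?case
    using gen_grade[of "f \<bullet> v" j "Hb 0"]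
    by (simp only: smul_var_y hv_parity.simps add_0 flip: U.scale_scale)
qed

text \<open>
  Since \<open>H\<^sub>0\<close> is central and \<open>L\<^sub>0\<close> measures weights, a basis element acts semilinearly: it moves past a
  polynomial at the price of a translation by its weight. So on generators of the module over \<open>U(\<hh>)\<close> every
  basis element is given by polynomials.
\<close>

lemma gen_smul: "gen b (f \<bullet> v) = shift (weight b) f \<bullet> gen b v"
proof (induction f rule: bivariate_induct)
  case (cst c) then show ?case by (simp add: smul_cst act_right.scale)
next
  case (add f g) then show ?case by (simp add: U.scale_left_distrib act_right.add)
next
  case (x f)
  have "gen b (gen (Lb 0) v) = gen (Lb 0) (gen b v) + scale (weight b) (gen b v)" for v
    using gen_bracket[of "Lb 0" b v] unfolding hv_br_L0 act_left.scale
    by (simp add: koszul_def algebra_simps mdl.scale_minus_left)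
  then show ?case using x
    by (simp add: U.scale_left_distrib distrib_right smul_var_x smul_cst flip: U.scale_scale)
next
  case (y f)
  have "gen b (gen (Hb 0) v) = gen (Hb 0) (gen b v)" for v
    using gen_bracket[of "Hb 0" b v] by (simp add: hv_br_H0 koszul_def)
  then show ?case using y by (simp add: smul_var_y flip: U.scale_scale)
qed

lemma hv_supermodule_parity_change: "hv_supermodule scale (parity_change M) act"
proof unfold_locales
  show "mdl.subspace (parity_change M i)" for i
    by (simp add: parity_change_def mdl.subspace_grade)
  show "parity_change M 0 \<inter> parity_change M 1 = {0}"
    using mdl.grade_disjoint by (auto simp: parity_change_def)
  show "\<exists>a\<in>parity_change M 0. \<exists>b\<in>parity_change M 1. v = a + b" for v
    using mdl.grade_span[of v] by (simp add: parity_change_def) (metis add.commute)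
  show "act x v \<in> parity_change M (i + j)" if "x \<in> hv_grade i" "v \<in> parity_change M j" for x v i j
    using act_grade[of x i v "j + 1"] that by (simp add: parity_change_def add.assoc)
  show "act (hv_bracket x y) v = act x (act y v) - scale (koszul i j) (act y (act x v))"
    if "x \<in> hv_grade i" "y \<in> hv_grade j" for x y v i j
    using that by (rule act_bracket)
qed

lemma grade_eq_0: "v \<in> M i \<Longrightarrow> v \<in> M (i + 1) \<Longrightarrow> v = 0"
  using mdl.grade_disjoint by (cases i) auto

section \<open>Each parity is free of rank one\<close>

text \<open>
  The projection onto \<open>M i\<close> along the other parity is an idempotent matrix over \<open>\<complex>[x,y]\<close>, with columns
  \<open>(a,c)\<close> and \<open>(b,d)\<close>. When its trace is 1 and its determinant 0, it is a column \<open>(u1,u2)\<close> times a row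
  \<open>(v1,v2)\<close>, and the trace condition \<open>v1 u1 + v2 u2 = 1\<close> makes the column a free generator of the image.
\<close>

lemma homogeneous_generator:
  assumes gens: "\<And>v. \<exists>f g. v = f \<bullet> b1 + g \<bullet> b2"
    and indep: "\<And>f g. f \<bullet> b1 + g \<bullet> b2 = 0 \<Longrightarrow> f = 0 \<and> g = 0"
    and comps: "a \<bullet> b1 + c \<bullet> b2 \<in> M i" "b \<bullet> b1 + d \<bullet> b2 \<in> M i"
    and compl: "b1 - (a \<bullet> b1 + c \<bullet> b2) \<in> M (i + 1)" "b2 - (b \<bullet> b1 + d \<bullet> b2) \<in> M (i + 1)"
    and trace: "a + d = 1" and det: "a * d = b * c"
  obtains e where "M i = range (\<lambda>f. f \<bullet> e)" "\<And>f. f \<bullet> e = 0 \<Longrightarrow> f = 0"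
proof -
  obtain u1 u2 v1 v2 where fac: "a = u1 * v1" "b = u1 * v2" "c = u2 * v1" "d = u2 * v2"
    by (rule rank_one_factorization[OF det])
  have one: "v1 * u1 + v2 * u2 = 1" using trace fac by (simp add: mult.commute)
  define e where "e = u1 \<bullet> b1 + u2 \<bullet> b2"
  have p1: "a \<bullet> b1 + c \<bullet> b2 = v1 \<bullet> e" and p2: "b \<bullet> b1 + d \<bullet> b2 = v2 \<bullet> e"
    by (simp_all add: e_def fac U.scale_right_distrib mult.commute)
  have "e = (v1 * u1 + v2 * u2) \<bullet> e" by (simp add: one)
  also have "\<dots> = u1 \<bullet> (v1 \<bullet> e) + u2 \<bullet> (v2 \<bullet> e)" by (simp add: U.scale_left_distrib mult.commute)
  also have "\<dots> \<in> M i"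
    using comps smul_grade[of "v1 \<bullet> e" i u1] smul_grade[of "v2 \<bullet> e" i u2] mdl.subspace_add[OF mdl.subspace_grade]
    unfolding p1 p2 by blast
  finally have eM: "e \<in> M i" .
  show ?thesis
  proof
    show "M i = range (\<lambda>f. f \<bullet> e)"
    proof
      show "M i \<subseteq> range (\<lambda>f. f \<bullet> e)"
      proof
        fix v assume v: "v \<in> M i"
        obtain f g where fg: "v = f \<bullet> b1 + g \<bullet> b2" using gens by blast
        let ?p = "(f * v1 + g * v2) \<bullet> e"
        have "v - ?p = f \<bullet> (b1 - v1 \<bullet> e) + g \<bullet> (b2 - v2 \<bullet> e)"
          by (simp add: fg U.scale_right_diff_distrib U.scale_left_distrib)
        moreover have "\<dots> \<in> M (i + 1)"
          using compl unfolding p1 p2 by (intro mdl.subspace_add[OF mdl.subspace_grade] smul_grade)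
        moreover have "v - ?p \<in> M i"
          by (intro mdl.subspace_diff[OF mdl.subspace_grade] smul_grade v eM)
        ultimately have "v - ?p = 0" using grade_eq_0[of "v - ?p" i] by simp
        then show "v \<in> range (\<lambda>f. f \<bullet> e)" by auto
      qed
      show "range (\<lambda>f. f \<bullet> e) \<subseteq> M i" using smul_grade[OF eM] by auto
    qed
    fix f assume "f \<bullet> e = 0"
    then have "(f * u1) \<bullet> b1 + (f * u2) \<bullet> b2 = 0" by (simp add: e_def U.scale_right_distrib)
    then have "f * u1 = 0" "f * u2 = 0" using indep by blast+
    then have "f * (v1 * u1 + v2 * u2) = 0" by algebra
    then show "f = 0" by (simp add: one)
  qed
qed

text \<open>
  \<open>2 L\<^sub>0\<close> is the anticommutator of \<open>G\<^sub>1\<^sub>/\<^sub>2\<close> and \<open>G\<^sub>-\<^sub>1\<^sub>/\<^sub>2\<close>, without central term as \<open>4p\<^sup>2 - 1 = 0\<close>.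
\<close>

lemma var_x_smul_eq_0_if_G_trivial:
  assumes "\<And>n v. gen (Gb n) v = 0"
  shows "var_x \<bullet> v = 0"
proof -
  have "scale 2 (gen (Lb 0) v) = 0"
    using gen_bracket[of "Gb 0" "Gb (-1)" v] assms
    by (simp add: act_left.add act_single[of _ 2] power2_eq_square koszul_def)
  then show ?thesis by (simp add: smul_var_x)
qed

text \<open>
  If one parity is missing, the odd elements have nowhere to map to.
\<close>

lemma var_x_smul_eq_0_if_parity_missing:
  assumes "M i = {0}"
  shows "var_x \<bullet> v = 0"
proof (rule var_x_smul_eq_0_if_G_trivial)
  fix n v
  have 1: "x = 0" if "x \<in> M i" for x using assms that by simp
  obtain a b where ab: "a \<in> M 0" "b \<in> M 1" "v = a + b" using mdl.grade_span by blast
  have "gen (Gb n) a \<in> M 1" "gen (Gb n) b \<in> M 0"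
    using gen_grade[OF ab(1), of "Gb n"] gen_grade[OF ab(2), of "Gb n"] by auto
  moreover from this have "gen (Gb n) a = 0 \<and> b = 0 \<or> gen (Gb n) b = 0 \<and> a = 0"
    using ab 1 by (cases i) auto
  ultimately show "gen (Gb n) v = 0" using ab by (auto simp: act_right.add)
qed

lemma free_basis_two:
  assumes "free_of_rank smul 2"
  obtains b1 b2 where "\<And>v. \<exists>f g. v = f \<bullet> b1 + g \<bullet> b2"
    "\<And>f g. f \<bullet> b1 + g \<bullet> b2 = 0 \<Longrightarrow> f = 0 \<and> g = 0"
proof -
  obtain B where B: "finite B" "card B = 2" "\<not> U.dependent B" "U.span B = UNIV"
    using assms unfolding free_of_rank_def by blast
  then obtain b1 b2 where b: "B = {b1, b2}" "b1 \<noteq> b2" by (auto simp: card_2_iff)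
  show ?thesis
  proof
    fix v
    have "v \<in> U.span {b1, b2}" using B b by auto
    then show "\<exists>f g. v = f \<bullet> b1 + g \<bullet> b2"
      by (auto simp: U.span_insert U.span_singleton) (metis add.commute diff_add_cancel)
  next
    fix f g assume "f \<bullet> b1 + g \<bullet> b2 = 0"
    then have "(\<Sum>v\<in>B. (if v = b1 then f else g) \<bullet> v) = 0" using b by auto
    then show "f = 0 \<and> g = 0"
      using U.independentD[OF B(3) B(1) order.refl, of "\<lambda>v. if v = b1 then f else g"] b
      by (metis insertI1 insertI2)
  qed
qed

end

locale rank_one_parts = hv_supermodule scale M act
  for scale :: "complex \<Rightarrow> 'm::ab_group_add \<Rightarrow> 'm" and M :: "bit \<Rightarrow> 'm set"
    and act :: "hv \<Rightarrow> 'm \<Rightarrow> 'm" +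
  fixes u w :: 'm
  assumes even_part: "M 0 = range (\<lambda>f. f \<bullet> u)" and odd_part: "M 1 = range (\<lambda>f. f \<bullet> w)"
    and smul_u_eq_0: "f \<bullet> u = 0 \<Longrightarrow> f = 0" and smul_w_eq_0: "f \<bullet> w = 0 \<Longrightarrow> f = 0"

context hv_supermodule
begin

text \<open>
  An idempotent \<open>2\<times>2\<close> matrix over a domain is 0, 1, or of trace 1 and determinant 0. In the first two cases
  one parity vanishes and \<open>L\<^sub>0\<close> acts by 0 on a free module, which is absurd. In the third case both the matrix
  and its complement have a free image of rank one.
\<close>

lemma rank_one_parts_exist:
  assumes "free_of_rank smul 2"
  obtains u w where "rank_one_parts scale M act u w"
proof -
  obtain b1 b2 where gens: "\<And>v. \<exists>f g. v = f \<bullet> b1 + g \<bullet> b2"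
    and indep: "\<And>f g. f \<bullet> b1 + g \<bullet> b2 = 0 \<Longrightarrow> f = 0 \<and> g = 0"
    using free_basis_two[OF assms] by blast
  have inj: "f = f' \<and> g = g'" if "f \<bullet> b1 + g \<bullet> b2 = f' \<bullet> b1 + g' \<bullet> b2" for f g f' g'
    using indep[of "f - f'" "g - g'"] that by (simp add: U.scale_left_diff_distrib algebra_simps)
  obtain p1 q1 where pq1: "p1 \<in> M 0" "q1 \<in> M 1" "b1 = p1 + q1" using mdl.grade_span by blast
  obtain p2 q2 where pq2: "p2 \<in> M 0" "q2 \<in> M 1" "b2 = p2 + q2" using mdl.grade_span by blast
  obtain a c where ac: "p1 = a \<bullet> b1 + c \<bullet> b2" using gens by blast
  obtain b d where bd: "p2 = b \<bullet> b1 + d \<bullet> b2" using gens by blast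
  have q: "q1 = b1 - p1" "q2 = b2 - p2" using pq1 pq2 by auto
  \<comment> \<open>The projection fixes the elements of \<open>M 0\<close>; applied to \<open>p1\<close> and \<open>p2\<close> this is idempotency of the
    matrix.\<close>
  have idem: "f \<bullet> p1 + g \<bullet> p2 = v" if v: "v \<in> M 0" "v = f \<bullet> b1 + g \<bullet> b2" for f g v
  proof -
    have "v - (f \<bullet> p1 + g \<bullet> p2) = f \<bullet> q1 + g \<bullet> q2"
      by (simp add: v q U.scale_right_diff_distrib)
    moreover have "\<dots> \<in> M 1" using pq1 pq2 by (intro mdl.subspace_add[OF mdl.subspace_grade] smul_grade)
    moreover have "v - (f \<bullet> p1 + g \<bullet> p2) \<in> M 0"
      using pq1 pq2 v by (intro mdl.subspace_add mdl.subspace_diff mdl.subspace_grade smul_grade)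
    ultimately show ?thesis using grade_eq_0[of "v - (f \<bullet> p1 + g \<bullet> p2)" 0] by simp
  qed
  have "(a * a + c * b) \<bullet> b1 + (a * c + c * d) \<bullet> b2 = a \<bullet> b1 + c \<bullet> b2"
    using idem[OF pq1(1) ac] unfolding ac bd
    by (simp add: U.scale_left_distrib U.scale_right_distrib algebra_simps)
  from inj[OF this] have e1: "a * a + c * b = a" "a * c + c * d = c" by auto
  have "(b * a + d * b) \<bullet> b1 + (b * c + d * d) \<bullet> b2 = b \<bullet> b1 + d \<bullet> b2"
    using idem[OF pq2(1) bd] unfolding ac bd
    by (simp add: U.scale_left_distrib U.scale_right_distrib algebra_simps)
  from inj[OF this] have e2: "b * a + d * b = b" "b * c + d * d = d" by auto
  have xb: "var_x \<bullet> b1 \<noteq> 0"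
    using indep[of var_x 0] by (auto simp: var_x_def)
  have triv: False if i: "i = 0 \<and> p1 = 0 \<and> p2 = 0 \<or> i = 1 \<and> q1 = 0 \<and> q2 = 0" for i :: bit
  proof -
    have "v = 0" if v: "v \<in> M i" for v
    proof -
      obtain f g where fg: "v = f \<bullet> b1 + g \<bullet> b2" using gens by blast
      have "v = (f \<bullet> p1 + g \<bullet> p2) + (f \<bullet> q1 + g \<bullet> q2)"
        by (simp add: fg pq1(3) pq2(3) U.scale_right_distrib algebra_simps)
      moreover have "f \<bullet> p1 + g \<bullet> p2 \<in> M 0" "f \<bullet> q1 + g \<bullet> q2 \<in> M 1"
        by (intro mdl.subspace_add[OF mdl.subspace_grade] smul_grade pq1(1,2) pq2(1,2))+
      ultimately have "v \<in> M (i + 1)" using i by fastforce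
      then show ?thesis using grade_eq_0 v by blast
    qed
    then have "M i = {0}" using mdl.subspace_0[OF mdl.subspace_grade] by auto
    then show False using var_x_smul_eq_0_if_parity_missing xb by blast
  qed
  have trace: "a + d = 1"
  proof (rule ccontr)
    assume ne: "a + d \<noteq> 1"
    have "b * (a + d - 1) = (b * a + d * b) - b" "c * (a + d - 1) = (a * c + c * d) - c"
      "(a - d) * (a + d - 1) = ((a * a + c * b) - a) - ((b * c + d * d) - d)"
      by (simp_all add: algebra_simps)
    then have "b * (a + d - 1) = 0" "c * (a + d - 1) = 0" "(a - d) * (a + d - 1) = 0"
      unfolding e1 e2 by simp_all
    then have z: "b = 0" "c = 0" "a = d" using ne by auto
    then have "a * (a - 1) = 0" using e1 by (simp add: algebra_simps)
    then have "a = 0 \<or> a = 1" by auto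
    then show False
    proof
      assume "a = 0"
      then have "p1 = 0" "p2 = 0" unfolding ac bd using z by simp_all
      then show False using triv[of 0] by simp
    next
      assume "a = 1"
      then have "q1 = 0" "q2 = 0" unfolding q ac bd using z by simp_all
      then show False using triv[of 1] by simp
    qed
  qed
  have det: "a * d = b * c"
  proof -
    have "a * d - b * c = a * (a + d) - (a * a + c * b)" by (simp add: algebra_simps)
    then show ?thesis unfolding e1 trace by simp
  qed
  obtain u where u: "M 0 = range (\<lambda>f. f \<bullet> u)" "\<And>f. f \<bullet> u = 0 \<Longrightarrow> f = 0"
  proof (rule homogeneous_generator[OF gens indep, where i = 0])
    show "a \<bullet> b1 + c \<bullet> b2 \<in> M 0" "b \<bullet> b1 + d \<bullet> b2 \<in> M 0"
      using pq1(1) pq2(1) unfolding ac bd .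
    show "b1 - (a \<bullet> b1 + c \<bullet> b2) \<in> M (0 + 1)" "b2 - (b \<bullet> b1 + d \<bullet> b2) \<in> M (0 + 1)"
      using pq1(2) pq2(2) unfolding q ac bd add_0 .
    show "a + d = 1" "a * d = b * c" by (rule trace det)+
  qed blast+
  obtain w where w: "M 1 = range (\<lambda>f. f \<bullet> w)" "\<And>f. f \<bullet> w = 0 \<Longrightarrow> f = 0"
  proof (rule homogeneous_generator[OF gens indep, where i = 1])
    have 1: "(1 - a) \<bullet> b1 + - c \<bullet> b2 = q1" "- b \<bullet> b1 + (1 - d) \<bullet> b2 = q2"
      unfolding q ac bd by (simp_all add: U.scale_left_diff_distrib)
    show "(1 - a) \<bullet> b1 + - c \<bullet> b2 \<in> M 1" "- b \<bullet> b1 + (1 - d) \<bullet> b2 \<in> M 1"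
      unfolding 1 by (rule pq1(2) pq2(2))+
    have 2: "b1 - q1 = p1" "b2 - q2 = p2" "(1 + 1 :: bit) = 0" by (simp_all add: q)
    show "b1 - ((1 - a) \<bullet> b1 + - c \<bullet> b2) \<in> M (1 + 1)" "b2 - (- b \<bullet> b1 + (1 - d) \<bullet> b2) \<in> M (1 + 1)"
      unfolding 1 2 by (rule pq1(1) pq2(1))+
    show "1 - a + (1 - d) = 1" using trace by (simp add: algebra_simps)
    show "(1 - a) * (1 - d) = - b * - c" using trace det by (simp add: algebra_simps)
  qed blast+
  show ?thesis
    by (rule that[of u w]) (unfold_locales, fact+)
qed

end

section \<open>The action of \<open>G\<^sub>1\<^sub>/\<^sub>2\<close> and \<open>G\<^sub>-\<^sub>1\<^sub>/\<^sub>2\<close>\<close>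

context rank_one_parts
begin

lemma smul_u_inject [simp]: "f \<bullet> u = g \<bullet> u \<longleftrightarrow> f = g"
  using smul_u_eq_0[of "f - g"] by (auto simp: U.scale_left_diff_distrib)

lemma smul_w_inject [simp]: "f \<bullet> w = g \<bullet> w \<longleftrightarrow> f = g"
  using smul_w_eq_0[of "f - g"] by (auto simp: U.scale_left_diff_distrib)

lemma u_even: "u \<in> M 0" and w_odd: "w \<in> M 1"
proof -
  have "1 \<bullet> u \<in> M 0" unfolding even_part by (rule rangeI)
  then show "u \<in> M 0" by simp
  have "1 \<bullet> w \<in> M 1" unfolding odd_part by (rule rangeI)
  then show "w \<in> M 1" by simp
qed

lemma even_gen_coeffs:
  assumes "hv_parity b = 0"
  obtains a a' where "gen b u = a \<bullet> u" "gen b w = a' \<bullet> w"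
proof -
  have "gen b u \<in> M 0" "gen b w \<in> M 1"
    using gen_grade[OF u_even, of b] gen_grade[OF w_odd, of b] assms by simp_all
  then show ?thesis using that unfolding even_part odd_part by blast
qed

lemma odd_gen_coeffs:
  assumes "hv_parity b = 1"
  obtains a a' where "gen b u = a \<bullet> w" "gen b w = a' \<bullet> u"
proof -
  have "gen b u \<in> M 1" "gen b w \<in> M 0"
    using gen_grade[OF u_even, of b] gen_grade[OF w_odd, of b] assms by simp_all
  then show ?thesis using that unfolding even_part odd_part by blast
qed

lemma rank_one_parts_parity_change:
  "rank_one_parts scale (parity_change M) act w u"
  by (intro rank_one_parts.intro hv_supermodule_parity_change rank_one_parts_axioms.intro)
    (simp_all add: parity_change_def even_part odd_part smul_u_eq_0 smul_w_eq_0)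

lemma G_square: "gen (Gb n) (gen (Gb n) v) = gen (Lb (2 * n + 1)) v"
proof -
  have "2 * n + 1 \<noteq> 0" by presburger
  then have "scale 2 (gen (Lb (2 * n + 1)) v) = gen (Gb n) (gen (Gb n) v) + gen (Gb n) (gen (Gb n) v)"
    using gen_bracket[of "Gb n" "Gb n" v]
    by (simp add: act_left.add act_single[of _ 2] koszul_def flip: mult_2)
  also have "\<dots> = scale 2 (gen (Gb n) (gen (Gb n) v))"
    using mdl.scale_left_distrib[of 1 1 "gen (Gb n) (gen (Gb n) v)"] by simp
  finally show ?thesis by simp
qed

lemma G_anticommutator:
  "gen (Gb 0) (gen (Gb (-1)) v) + gen (Gb (-1)) (gen (Gb 0) v) = (cst 2 * var_x) \<bullet> v"
  using gen_bracket[of "Gb 0" "Gb (-1)" v]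
  by (simp add: act_left.add act_single[of _ 2] koszul_def power2_eq_square smul_cst smul_var_x
      flip: U.scale_scale)

text \<open>
  Write the anticommutator of \<open>G\<^sub>1\<^sub>/\<^sub>2\<close> and \<open>G\<^sub>-\<^sub>1\<^sub>/\<^sub>2\<close> on both generators and translate the second identity by
  \<open>-1/2\<close>. Subtracting the two cancels one product and shows that \<open>F = B(x + 1/2) A'(x)\<close> satisfies
  \<open>F(x) - F(x - 1) = 1\<close>, so \<open>F\<close> is \<open>x + c(y)\<close>; the other product is then \<open>2x - F\<close>.
\<close>

lemma G_half_coeffs:
  assumes "gen (Gb 0) u = A \<bullet> w" "gen (Gb 0) w = A' \<bullet> u"
    and "gen (Gb (-1)) u = B \<bullet> w" "gen (Gb (-1)) w = B' \<bullet> u"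
  obtains c where "shift (1 / 2) B * A' = var_x + in_y c" "shift (- 1 / 2) A * B' = var_x - in_y c"
proof -
  have wt: "weight (Gb 0) = 1 / 2" "weight (Gb (-1)) = - 1 / 2" by simp_all
  have 1: "shift (1 / 2) B * A' + shift (- 1 / 2) A * B' = cst 2 * var_x"
    using G_anticommutator[of u] unfolding assms gen_smul wt
    by (simp flip: U.scale_left_distrib)
  have 2: "shift (1 / 2) B' * A + shift (- 1 / 2) A' * B = cst 2 * var_x"
    using G_anticommutator[of w] unfolding assms gen_smul wt
    by (simp flip: U.scale_left_distrib)
  have "shift (- 1 / 2) (shift (1 / 2) B' * A + shift (- 1 / 2) A' * B) = cst 2 * var_x + cst (- 1)"
    unfolding 2 by (simp add: distrib_left flip: cst_simps(4))
  then have "B' * shift (- 1 / 2) A + shift (- 1) A' * shift (- 1 / 2) B = cst 2 * var_x - 1"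
    by (simp add: cst_simps)
  moreover have "shift (1 / 2) B * A' - shift (- 1) (shift (1 / 2) B * A')
      = (shift (1 / 2) B * A' + shift (- 1 / 2) A * B')
        - (B' * shift (- 1 / 2) A + shift (- 1) A' * shift (- 1 / 2) B)"
    by (simp add: mult.commute)
  ultimately have "shift (1 / 2) B * A' - shift (- 1) (shift (1 / 2) B * A') = 1"
    unfolding 1 by simp
  then obtain c where c: "shift (1 / 2) B * A' = var_x + in_y c" by (rule unit_difference_linear)
  have "cst 2 = 2" by (simp add: cst_num)
  then have "shift (- 1 / 2) A * B' = var_x - in_y c" using 1 c by (simp add: algebra_simps)
  with c show ?thesis by (rule that)
qed

text \<open>
  The bracket \<open>[L\<^sub>-\<^sub>2\<^sub>n, L\<^sub>n] = - 3n L\<^sub>-\<^sub>n\<close> forbids this: if \<open>L\<^sub>-\<^sub>2\<^sub>n\<close> acts by a polynomial \<open>d\<close>, the left-hand side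
  acts by a polynomial with nonzero coefficient in degree \<open>1 + deg d\<close>, whereas the right-hand side is a
  constant.
\<close>

lemma no_quadratic_against_constant:
  assumes "n \<noteq> 0" "gen (Lb n) u = P \<bullet> u" "degree P = 2" "gen (Lb (- n)) u = cst k \<bullet> u" "k \<noteq> 0"
  shows False
proof -
  obtain d where d: "gen (Lb (- 2 * n)) u = d \<bullet> u"
    using even_gen_coeffs[of "Lb (- 2 * n)"] by auto
  define X where "X = shift (of_int (- 2 * n)) P * d - shift (of_int n) d * P"
  have br: "hv_br (Lb (- 2 * n)) (Lb n) = Poly_Mapping.single (Lb (- n)) (of_int (- 3 * n))"
    using assms(1) by simp
  have "X \<bullet> u = gen (Lb (- 2 * n)) (gen (Lb n) u) - gen (Lb n) (gen (Lb (- 2 * n)) u)"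
    unfolding X_def assms(2) d gen_smul by (simp add: U.scale_left_diff_distrib)
  also have "\<dots> = act (hv_br (Lb (- 2 * n)) (Lb n)) u"
    using gen_bracket[of "Lb (- 2 * n)" "Lb n" u] by (simp add: koszul_def)
  also have "\<dots> = scale (of_int (- 3 * n)) (cst k \<bullet> u)"
    unfolding br act_single[of _ "of_int (- 3 * n)"] assms(4) ..
  also have "\<dots> = cst (of_int (- 3 * n) * k) \<bullet> u" by (simp add: smul_cst)
  finally have X: "X = cst (of_int (- 3 * n) * k)" by simp
  then have "X \<noteq> 0" using assms by (simp add: cst_def)
  then have "d \<noteq> 0" unfolding X_def by auto
  have "of_nat (Suc 1) * of_int (- 2 * n) \<noteq> of_nat (degree d) * (of_int n :: complex)"
  proof
    assume eq: "of_nat (Suc 1) * of_int (- 2 * n) = of_nat (degree d) * (of_int n :: complex)"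
    have "of_int n * (of_nat (degree d + 4) :: complex)
        = of_nat (degree d) * of_int n - of_nat (Suc 1) * of_int (- 2 * n)"
      by (simp add: algebra_simps)
    then have "of_int n * (of_nat (degree d + 4) :: complex) = 0" unfolding eq by simp
    then show False using assms(1) by (simp del: of_nat_add)
  qed
  then have "coeff X (1 + degree d) \<noteq> 0"
    unfolding X_def using assms(3) \<open>d \<noteq> 0\<close> by (intro twisted_commutator_coeff) auto
  then show False unfolding X by (simp add: cst_def)
qed

text \<open>
  Each of the products \<open>x + c\<close> and \<open>x - c\<close> has one constant and one linear factor, which leaves four cases.
  In two of them \<open>G\<^sub>1\<^sub>/\<^sub>2\<close> and \<open>G\<^sub>-\<^sub>1\<^sub>/\<^sub>2\<close> are both constant on the same generator; these two are exchanged by the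
  parity change. In the other two one of them is constant on both generators and the other linear on both, so
  of their squares \<open>L\<^sub>1\<close> and \<open>L\<^sub>-\<^sub>1\<close> one acts on \<open>u\<close> by a constant and the other by a quadratic polynomial.
\<close>

lemma normal_form_up_to_parity:
  obtains (even) k k' where "k \<noteq> 0" "k' \<noteq> 0" "gen (Gb 0) u = cst k \<bullet> w" "gen (Gb (-1)) u = cst k' \<bullet> w"
  | (odd) k k' where "k \<noteq> 0" "k' \<noteq> 0" "gen (Gb 0) w = cst k \<bullet> u" "gen (Gb (-1)) w = cst k' \<bullet> u"
proof -
  obtain A A' where A: "gen (Gb 0) u = A \<bullet> w" "gen (Gb 0) w = A' \<bullet> u"
    using odd_gen_coeffs[of "Gb 0"] by auto
  obtain B B' where B: "gen (Gb (-1)) u = B \<bullet> w" "gen (Gb (-1)) w = B' \<bullet> u"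
    using odd_gen_coeffs[of "Gb (-1)"] by auto
  obtain c where c: "shift (1 / 2) B * A' = var_x + in_y c" "shift (- 1 / 2) A * B' = var_x - in_y c"
    using G_half_coeffs[OF A B] .
  have c': "shift (- 1 / 2) A * B' = var_x + in_y (- c)" using c(2) by (simp add: in_y_def)
  have L1: "gen (Lb 1) u = (shift (1 / 2) A * A') \<bullet> u"
    using G_square[of 0 u] by (simp add: A gen_smul)
  have L_1: "gen (Lb (-1)) u = (shift (- 1 / 2) B * B') \<bullet> u"
    using G_square[of "-1" u] by (simp add: B gen_smul)
  obtain k where k: "k \<noteq> 0" "B = cst k \<or> A' = cst k"
    using monic_linear_factor[OF c(1)] shift_eq_cst by blast
  obtain k' where k': "k' \<noteq> 0" "A = cst k' \<or> B' = cst k'"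
    using monic_linear_factor[OF c'] shift_eq_cst by blast
  consider "B = cst k" "A = cst k'" | "A' = cst k" "B' = cst k'"
    | "B = cst k" "B' = cst k'" | "A' = cst k" "A = cst k'" using k(2) k'(2) by blast
  then show ?thesis
  proof cases
    case 1 then show ?thesis using even[of k' k] A B k k' by simp
  next
    case 2 then show ?thesis using odd[of k k'] A B k k' by simp
  next
    case 3
    have "degree A' = 1" using degree_linear_factor[of k A' c] c 3 by simp
    moreover have "degree A = 1"
      using degree_linear_factor[of k' "shift (- 1 / 2) A"] c' 3 by (simp add: mult.commute)
    ultimately have "degree (shift (1 / 2) A * A') = 2" by (subst degree_mult_eq) auto
    moreover have "gen (Lb (- 1)) u = cst (k * k') \<bullet> u" using L_1 3 by (simp add: cst_simps)
    ultimately show ?thesis using no_quadratic_against_constant[OF _ L1, of "k * k'"] k k' by simp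
  next
    case 4
    have "degree B' = 1" using degree_linear_factor[of k' B'] c' 4 by simp
    moreover have "degree B = 1"
      using degree_linear_factor[of k "shift (1 / 2) B"] c 4 by (simp add: mult.commute)
    ultimately have "degree (shift (- 1 / 2) B * B') = 2" by (subst degree_mult_eq) auto
    moreover have "gen (Lb 1) u = cst (k' * k) \<bullet> u" using L1 4 by (simp add: cst_simps)
    ultimately show ?thesis using no_quadratic_against_constant[OF _ L_1, of "k' * k"] k k' by simp
  qed
qed

end

section \<open>Comparison with \<open>\<Omega>(\<lambda>,\<beta>)\<close>\<close>

text \<open>
  \<open>G\<^sub>1\<^sub>/\<^sub>2\<close> and \<open>G\<^sub>-\<^sub>1\<^sub>/\<^sub>2\<close> act on \<open>u\<close> and \<open>w\<close> as they act on the two unit polynomials of \<open>\<Omega>(\<lambda>,\<beta>)\<close>.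
\<close>

locale normalised = rank_one_parts scale M act u w
  for scale :: "complex \<Rightarrow> 'm::ab_group_add \<Rightarrow> 'm" and M :: "bit \<Rightarrow> 'm set"
    and act :: "hv \<Rightarrow> 'm \<Rightarrow> 'm" and u w :: 'm +
  fixes l :: complex and \<beta> :: "complex poly"
  assumes l_nonzero: "l \<noteq> 0"
    and G_plus_u: "gen (Gb 0) u = w" and G_minus_u: "gen (Gb (-1)) u = cst (1 / l) \<bullet> w"
    and G_plus_w: "gen (Gb 0) w = (cst l * (var_x + in_y \<beta>)) \<bullet> u"
    and G_minus_w: "gen (Gb (-1)) w = (var_x - in_y \<beta>) \<bullet> u"

text \<open>
  Taking \<open>G\<^sub>1\<^sub>/\<^sub>2 u\<close> as the generator \<open>w'\<close> of the odd part, \<open>\<lambda>\<close> is read off from \<open>G\<^sub>-\<^sub>1\<^sub>/\<^sub>2 u = \<lambda>\<^sup>-\<^sup>1 w'\<close>, and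
  \<open>\<beta>\<close> is the polynomial \<open>c\<close> of the linear factors.
\<close>

lemma (in rank_one_parts) normalisation:
  assumes "k \<noteq> 0" "k' \<noteq> 0" "gen (Gb 0) u = cst k \<bullet> w" "gen (Gb (-1)) u = cst k' \<bullet> w"
  obtains w' l \<beta> where "normalised scale M act u w' l \<beta>"
proof -
  define w' where "w' = cst k \<bullet> w"
  have cst_inv: "cst (1 / k) * cst k = 1" using assms(1) by (simp flip: cst_simps)
  have w: "w = cst (1 / k) \<bullet> w'" unfolding w'_def by (simp add: cst_inv)
  interpret w': rank_one_parts scale M act u w'
  proof unfold_locales
    show "M 1 = range (\<lambda>f. f \<bullet> w')"
    proof -
      have "f \<bullet> w = (f * cst (1 / k)) \<bullet> w'" "f \<bullet> w' = (f * cst k) \<bullet> w" for f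
        using w unfolding w'_def by (simp_all add: mult.assoc cst_inv)
      then show ?thesis unfolding odd_part by (metis (no_types, lifting) rangeE rangeI subsetI subset_antisym)
    qed
    show "f = 0" if "f \<bullet> w' = 0" for f
    proof -
      have "f * cst k = 0" using that smul_w_eq_0[of "f * cst k"] unfolding w'_def by simp
      then show ?thesis using assms(1) by (simp add: cst_def)
    qed
  qed (fact even_part smul_u_eq_0)+
  define l where "l = k / k'"
  have l: "l \<noteq> 0" using assms by (simp add: l_def)
  have Gp: "gen (Gb 0) u = 1 \<bullet> w'" using assms by (simp add: w'_def)
  have Gm: "gen (Gb (-1)) u = cst (1 / l) \<bullet> w'"
    using assms unfolding w'_def by (simp add: l_def flip: cst_simps(4))
  obtain A' where A': "gen (Gb 0) w' = A' \<bullet> u" using w'.odd_gen_coeffs[of "Gb 0"] by auto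
  obtain B' where B': "gen (Gb (-1)) w' = B' \<bullet> u" using w'.odd_gen_coeffs[of "Gb (-1)"] by auto
  obtain c where c: "shift (1 / 2) (cst (1 / l)) * A' = var_x + in_y c" "shift (- 1 / 2) 1 * B' = var_x - in_y c"
    using w'.G_half_coeffs[OF Gp A' Gm B'] .
  have "cst l * cst (1 / l) = 1" using l by (simp flip: cst_simps)
  then have "A' = cst l * (cst (1 / l) * A')" by (metis mult.assoc mult_1)
  then have "A' = cst l * (var_x + in_y c)" using c(1) by (simp only: shift_simps)
  then have "normalised scale M act u w' l c"
    using l Gp Gm A' B' c(2) by unfold_locales simp_all
  then show ?thesis by (rule that)
qed

text \<open>
  The counterpart of \<open>gen_smul\<close> for the explicit action on \<open>\<Omega>(\<lambda>,\<beta>)\<close>.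
\<close>

lemma omega_gen_expand:
  "omega_gen l \<beta> b (f, g) =
    (shift (weight b) f * fst (omega_gen l \<beta> b (1, 0)) + shift (weight b) g * fst (omega_gen l \<beta> b (0, 1)),
     shift (weight b) f * snd (omega_gen l \<beta> b (1, 0)) + shift (weight b) g * snd (omega_gen l \<beta> b (0, 1)))"
  by (cases b) (simp_all add: mult_ac zero_prod_def)

context normalised
begin

definition \<phi> :: "omega \<Rightarrow> 'm" where
  "\<phi> v = fst v \<bullet> u + snd v \<bullet> w"

lemma \<phi>_add: "\<phi> (v + v') = \<phi> v + \<phi> v'"
  by (simp add: \<phi>_def U.scale_left_distrib)

lemma \<phi>_scale: "\<phi> (omega_scale c v) = scale c (\<phi> v)"
  by (simp add: \<phi>_def omega_scale_def mdl.scale_right_distrib smul_cst flip: U.scale_scale)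

lemma \<phi>_diff: "\<phi> (v - v') = \<phi> v - \<phi> v'"
  by (simp add: \<phi>_def U.scale_left_diff_distrib)

lemma \<phi>_eq_0: "\<phi> v = 0 \<Longrightarrow> v = 0"
proof -
  assume "\<phi> v = 0"
  then have eq: "fst v \<bullet> u = - (snd v \<bullet> w)" by (simp add: \<phi>_def eq_neg_iff_add_eq_0)
  have "fst v \<bullet> u \<in> M 0" "snd v \<bullet> w \<in> M 1" by (rule smul_grade u_even w_odd)+
  then have "fst v \<bullet> u = 0"
    using eq mdl.subspace_neg[OF mdl.subspace_grade] grade_eq_0[of "fst v \<bullet> u" 0] by simp
  then show "v = 0" using eq smul_u_eq_0 smul_w_eq_0 by (simp add: prod_eq_iff)
qed

lemma \<phi>_grade: "\<phi> ` omega_grade i = M i"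
proof (cases i)
  case zero
  have "\<phi> ` omega_grade 0 = range (\<lambda>f. f \<bullet> u)"
    by (auto simp: omega_grade_def \<phi>_def image_def)
  then show ?thesis using zero even_part by simp
next
  case one
  have "\<phi> ` omega_grade 1 = range (\<lambda>f. f \<bullet> w)"
    by (auto simp: omega_grade_def \<phi>_def image_def)
  then show ?thesis using one odd_part by simp
qed

lemma bij_\<phi>: "bij \<phi>"
proof (rule bijI)
  show "inj \<phi>"
    by (rule injI) (metis \<phi>_diff \<phi>_eq_0 eq_iff_diff_eq_0)
  show "surj \<phi>"
  proof
    show "UNIV \<subseteq> range \<phi>"
    proof
      fix v
      obtain a b where ab: "a \<in> M 0" "b \<in> M 1" "v = a + b" using mdl.grade_span by blast
      then obtain f g where "a = f \<bullet> u" "b = g \<bullet> w" using even_part odd_part by auto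
      then have "v = \<phi> (f, g)" using ab by (simp add: \<phi>_def)
      then show "v \<in> range \<phi>" by simp
    qed
  qed simp
qed

text \<open>
  The elements whose action is the one transported from \<open>\<Omega>(\<lambda>,\<beta>)\<close>. They form a subalgebra, because both
  sides are modules; the goal is to see that this subalgebra is everything.
\<close>

definition agree :: "hv \<Rightarrow> bool" where
  "agree x \<longleftrightarrow> (\<forall>v. act x (\<phi> v) = \<phi> (omega_act l \<beta> x v))"

lemma agree_zero: "agree 0"
  using \<phi>_scale[of 0 0] by (simp add: agree_def omega_act_minus)

lemma agree_add: "agree x \<Longrightarrow> agree y \<Longrightarrow> agree (x + y)"
  by (simp add: agree_def act_left.add omega_act_linear_left \<phi>_add)

lemma agree_scale: "agree x \<Longrightarrow> agree (hv_scale c x)"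
  by (simp add: agree_def act_left.scale omega_act_linear_left \<phi>_scale)

lemma agree_single: "agree (hv_elt b) \<Longrightarrow> agree (Poly_Mapping.single b c)"
  using agree_scale[of "hv_elt b" c] by simp

lemma agree_unsingle: "agree (Poly_Mapping.single b c) \<Longrightarrow> c \<noteq> 0 \<Longrightarrow> agree (hv_elt b)"
  using agree_scale[of "Poly_Mapping.single b c" "1 / c"] by simp

lemma agree_cancel:
  assumes "agree (Poly_Mapping.single a c + x)" "agree x" "c \<noteq> 0"
  shows "agree (hv_elt a)"
proof -
  have "agree ((Poly_Mapping.single a c + x) + hv_scale (- 1) x)"
    by (rule agree_add[OF assms(1) agree_scale[OF assms(2)]])
  then show ?thesis using assms(3) by (intro agree_unsingle[of a c]) simp_all
qed

lemma agree_gen: "agree (hv_elt b) \<Longrightarrow> gen b (\<phi> v) = \<phi> (omega_gen l \<beta> b v)"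
  unfolding agree_def by (metis omega_act_single omega_vs.scale_one)

lemma agree_bracket:
  assumes "agree (hv_elt a)" "agree (hv_elt b)"
  shows "agree (hv_br a b)"
  unfolding agree_def
proof
  fix v
  show "act (hv_br a b) (\<phi> v) = \<phi> (omega_act l \<beta> (hv_br a b) v)"
    by (simp add: gen_bracket omega_gen_bracket[OF l_nonzero] \<phi>_diff \<phi>_scale agree_gen assms)
qed

lemma agree_if_agree_on_generators:
  assumes "gen b u = \<phi> (omega_gen l \<beta> b (1, 0))" "gen b w = \<phi> (omega_gen l \<beta> b (0, 1))"
  shows "agree (hv_elt b)"
proof -
  have "gen b (\<phi> (f, g)) = \<phi> (omega_gen l \<beta> b (f, g))" for f g
    by (subst omega_gen_expand)
      (simp add: \<phi>_def act_right.add gen_smul assms U.scale_left_distrib U.scale_right_distrib)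
  then show ?thesis by (simp add: agree_def omega_act_single)
qed

text \<open>
  Both actions of \<open>b\<close> solve the same equation, the one expressing the bracket with \<open>L\<^sub>n\<close>. As \<open>L\<^sub>n\<close> acts by
  linear polynomials, the equation has at most one solution when the weight of \<open>b\<close> is no natural multiple of \<open>n\<close>.
  This is how elements enter the subalgebra that the
  elements already in it need not generate, such as \<open>L\<^sub>2\<close> from \<open>[L\<^sub>2, L\<^sub>-\<^sub>1] = 3 L\<^sub>1\<close>.
\<close>

lemma agree_if_bracket_agrees:
  assumes b: "hv_parity b = 0" "weight b = of_int m"
    and L: "agree (hv_elt (Lb n))" "agree (hv_br b (Lb n))"
    and ne: "\<And>i. m \<noteq> int i * n"
  shows "agree (hv_elt b)"
proof -
  have ne': "(of_int m :: complex) \<noteq> of_nat i * of_int n" for i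
    using ne[of i] by (metis of_int_eq_iff of_int_mult of_int_of_nat_eq)
  define P where "P = cst (l powi n) * (var_x + cst (of_int n) * in_y \<beta>)"
  define P' where "P' = cst (l powi n) * (var_x + cst (of_int n) * (in_y \<beta> + cst (1 / 2)))"
  obtain a a' where a: "gen b u = a \<bullet> u" "gen b w = a' \<bullet> w" using even_gen_coeffs[OF b(1)] .
  define c where "c = fst (omega_gen l \<beta> b (1, 0))"
  define c' where "c' = snd (omega_gen l \<beta> b (0, 1))"
  have c: "omega_gen l \<beta> b (1, 0) = (c, 0)" "omega_gen l \<beta> b (0, 1) = (0, c')"
    using b unfolding c_def c'_def by (cases b; simp add: zero_prod_def)+
  have L2: "act (hv_br b (Lb n)) (\<phi> v) = \<phi> (omega_act l \<beta> (hv_br b (Lb n)) v)" for v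
    using L(2) unfolding agree_def by blast
  note gL = agree_gen[OF L(1)]
  have Lu: "gen (Lb n) u = P \<bullet> u" using gL[of "(1, 0)"] by (simp add: \<phi>_def P_def)
  have Lw: "gen (Lb n) w = P' \<bullet> w" using gL[of "(0, 1)"] by (simp add: \<phi>_def P'_def)
  have br: "gen b (gen (Lb n) v) - gen (Lb n) (gen b v) = act (hv_br b (Lb n)) v" for v
    using gen_bracket[of b "Lb n" v] by (simp add: koszul_def)
  have obr: "omega_act l \<beta> (hv_br b (Lb n)) v
      = omega_gen l \<beta> b (omega_gen l \<beta> (Lb n) v) - omega_gen l \<beta> (Lb n) (omega_gen l \<beta> b v)" for v
    using omega_gen_bracket[OF l_nonzero, of \<beta> b "Lb n" v] by (simp add: koszul_def)
  have ob: "omega_gen l \<beta> b (f, g) = (shift (of_int m) f * c, shift (of_int m) g * c')" for f g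
    by (subst omega_gen_expand) (simp add: c b)
  have oL: "omega_gen l \<beta> (Lb n) (f, g) = (P * shift (of_int n) f, P' * shift (of_int n) g)" for f g
    by (simp add: P_def P'_def)
  have deg: "degree P = 1" "degree P' = 1"
    using l_nonzero by (simp_all add: P_def P'_def cst_def in_y_def var_x_def)
  have "(shift (of_int m) P * a - shift (of_int n) a * P) \<bullet> u = gen b (gen (Lb n) u) - gen (Lb n) (gen b u)"
    unfolding a Lu gen_smul b(2) by (simp add: U.scale_left_diff_distrib)
  also have "\<dots> = act (hv_br b (Lb n)) (\<phi> (1, 0))" unfolding br by (simp add: \<phi>_def)
  also have "\<dots> = (shift (of_int m) P * c - shift (of_int n) c * P) \<bullet> u"
    unfolding L2 obr oL ob by (simp add: \<phi>_def mult_ac)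
  finally have "a = c"
    unfolding smul_u_inject by (rule twisted_commutator_unique[OF deg(1)]) (rule ne')
  have "(shift (of_int m) P' * a' - shift (of_int n) a' * P') \<bullet> w = gen b (gen (Lb n) w) - gen (Lb n) (gen b w)"
    unfolding a Lw gen_smul b(2) by (simp add: U.scale_left_diff_distrib)
  also have "\<dots> = act (hv_br b (Lb n)) (\<phi> (0, 1))" unfolding br by (simp add: \<phi>_def)
  also have "\<dots> = (shift (of_int m) P' * c' - shift (of_int n) c' * P') \<bullet> w"
    unfolding L2 obr oL ob by (simp add: \<phi>_def mult_ac)
  finally have "a' = c'"
    unfolding smul_w_inject by (rule twisted_commutator_unique[OF deg(2)]) (rule ne')
  show ?thesis
    using \<open>a = c\<close> \<open>a' = c'\<close> by (intro agree_if_agree_on_generators) (simp_all add: a c \<phi>_def)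
qed

lemma agree_L0: "agree (hv_elt (Lb 0))"
  by (rule agree_if_agree_on_generators) (simp_all add: \<phi>_def cst_simps smul_var_x)

lemma agree_H0: "agree (hv_elt (Hb 0))"
  by (rule agree_if_agree_on_generators) (simp_all add: \<phi>_def cst_simps smul_var_y)

lemma agree_G_plus: "agree (hv_elt (Gb 0))"
  by (rule agree_if_agree_on_generators) (simp_all add: \<phi>_def cst_simps G_plus_u G_plus_w)

lemma agree_G_minus: "agree (hv_elt (Gb (-1)))"
  by (rule agree_if_agree_on_generators)
    (simp_all add: \<phi>_def cst_simps G_minus_u G_minus_w power_int_minus inverse_eq_divide)

text \<open>
  These are the squares of \<open>G\<^sub>1\<^sub>/\<^sub>2\<close> and \<open>G\<^sub>-\<^sub>1\<^sub>/\<^sub>2\<close>.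
\<close>

lemma agree_L_pm1: "agree (hv_elt (Lb 1))" "agree (hv_elt (Lb (-1)))"
  using agree_bracket[OF agree_G_plus agree_G_plus] agree_bracket[OF agree_G_minus agree_G_minus]
  by (simp_all add: agree_unsingle power2_eq_square)

lemma agree_L_pm2: "agree (hv_elt (Lb 2))" "agree (hv_elt (Lb (-2)))"
proof -
  show "agree (hv_elt (Lb 2))"
    by (rule agree_if_bracket_agrees[where m = "2" and n = "-1"]) (simp_all add: agree_L_pm1 agree_single)
  show "agree (hv_elt (Lb (-2)))"
    by (rule agree_if_bracket_agrees[where m = "-2" and n = 1]) (simp_all add: agree_L_pm1 agree_single)
qed

lemma agree_L_pos: "agree (hv_elt (Lb (int n + 2)))"
proof (induction n)
  case 0 then show ?case using agree_L_pm2 by simp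
next
  case (Suc n)
  have "agree (Poly_Mapping.single (Lb (int (Suc n) + 2)) (of_nat (Suc n)))"
    using agree_bracket[OF Suc agree_L_pm1(1)] by (simp add: add_ac)
  then show ?case by (rule agree_unsingle) (simp del: of_nat_Suc)
qed

lemma agree_L_neg: "agree (hv_elt (Lb (- int n - 2)))"
proof (induction n)
  case 0 then show ?case using agree_L_pm2 by simp
next
  case (Suc n)
  have "agree (Poly_Mapping.single (Lb (- int (Suc n) - 2)) (- of_nat (Suc n)))"
    using agree_bracket[OF Suc agree_L_pm1(2)] by (simp add: algebra_simps)
  then show ?case by (rule agree_unsingle) (simp del: of_nat_Suc)
qed

lemma agree_L: "agree (hv_elt (Lb n))"
proof -
  consider "n = 0" | "n = 1" | "n = - 1" | "n = int (nat (n - 2)) + 2" | "n = - int (nat (- n - 2)) - 2"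
    by linarith
  then show ?thesis
    using agree_L0 agree_L_pm1 agree_L_pos[of "nat (n - 2)"] agree_L_neg[of "nat (- n - 2)"]
    by cases (simp_all del: of_nat_nat int_nat_eq)
qed

lemma agree_C1: "agree (hv_elt C1)"
proof -
  have "agree (Poly_Mapping.single C1 (1 / 2) + Poly_Mapping.single (Lb 0) 4)"
    using agree_bracket[OF agree_L_pm2] by (simp add: add.commute power3_eq_cube)
  then show ?thesis by (rule agree_cancel) (simp_all add: agree_single agree_L)
qed

lemma agree_G: "agree (hv_elt (Gb n))"
proof (cases "n = 1")
  case True
  \<comment> \<open>\<open>[L\<^sub>1, G\<^sub>1\<^sub>/\<^sub>2] = 0\<close> gives no information, so \<open>G\<^sub>3\<^sub>/\<^sub>2\<close> comes from \<open>[L\<^sub>2, G\<^sub>-\<^sub>1\<^sub>/\<^sub>2]\<close>.\<close>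
  then show ?thesis using agree_bracket[OF agree_L agree_G_minus, of 2] by (simp add: agree_unsingle)
next
  case False
  have "agree (Poly_Mapping.single (Gb n) (of_int n / 2 - 1 / 2))"
    using agree_bracket[OF agree_L agree_G_plus, of n] by simp
  then show ?thesis by (rule agree_unsingle) (use False in simp)
qed

text \<open>
  \<open>H\<^sub>1\<close> is determined by \<open>[L\<^sub>-\<^sub>1, H\<^sub>1] = - H\<^sub>0\<close>. For \<open>H\<^sub>-\<^sub>1\<close> the mirror image \<open>[L\<^sub>1, H\<^sub>-\<^sub>1] = H\<^sub>0 + 2 C\<^sub>2\<close> involves
  the still unknown \<open>C\<^sub>2\<close>, so it is obtained from \<open>[L\<^sub>-\<^sub>2, H\<^sub>1] = - H\<^sub>-\<^sub>1\<close> instead.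
\<close>

lemma agree_H_pm1: "agree (hv_elt (Hb 1))" "agree (hv_elt (Hb (-1)))"
proof -
  show *: "agree (hv_elt (Hb 1))"
    by (rule agree_if_bracket_agrees[where m = "1" and n = "-1"]) (simp_all add: agree_L agree_H0 flip: single_uminus)
  show "agree (hv_elt (Hb (-1)))"
    using agree_bracket[OF agree_L *, of "-2"] by (simp add: agree_unsingle)
qed

lemma agree_C2: "agree (hv_elt C2)"
proof -
  have "agree (Poly_Mapping.single C2 2 + Poly_Mapping.single (Hb 0) 1)"
    using agree_bracket[OF agree_L agree_H_pm1(2), of 1] by (simp add: add.commute)
  then show ?thesis by (rule agree_cancel) (simp_all add: agree_H0)
qed

lemma agree_H: "agree (hv_elt (Hb n))"
proof -
  have "agree (Poly_Mapping.single (Hb n) (- 1)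
      + Poly_Mapping.single C2 (of_int (n - 1) ^ 2 + of_int (n - 1) when n = 0))"
    using agree_bracket[OF agree_L agree_H_pm1(1), of "n - 1"] by simp
  then show ?thesis by (rule agree_cancel) (simp_all add: agree_single agree_C2)
qed

lemma agree_Q: "agree (hv_elt (Qb n))"
  using agree_bracket[OF agree_H agree_G, of 1 "n - 1"] by simp

lemma agree_C3: "agree (hv_elt C3)"
  using agree_bracket[OF agree_H agree_H, of 1 "-1"] by simp

lemma agree_all: "agree x"
proof (induction x rule: hv_induct)
  case zero show ?case by (rule agree_zero)
next
  case (step b c x)
  have "agree (hv_elt b)"
    by (cases b) (simp_all add: agree_L agree_H agree_G agree_Q agree_C1 agree_C2 agree_C3)
  then show ?case using step by (intro agree_add agree_scale)
qed

lemma iso_omega: "supermodule_iso scale M act omega_scale omega_grade (omega_act l \<beta>)"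
  unfolding supermodule_iso_def
proof (intro exI[of _ "inv \<phi>"] conjI allI)
  have inv: "inv \<phi> (\<phi> v) = v" "\<phi> (inv \<phi> y) = y" for v y
    using bij_\<phi> by (simp_all add: bij_is_inj bij_is_surj surj_f_inv_f)
  show "Vector_Spaces.linear scale omega_scale (inv \<phi>)"
    by (intro linearI_vector_space mdl.vector_space_axioms omega_vector_space)
      (metis inv \<phi>_add, metis inv \<phi>_scale)
  show "bij (inv \<phi>)" using bij_\<phi> by (rule bij_imp_bij_inv)
  show "inv \<phi> ` M i = omega_grade i" for i
    unfolding \<phi>_grade[symmetric] by (simp add: image_image inv)
  show "inv \<phi> (act x v) = omega_act l \<beta> x (inv \<phi> v)" for x v
    using agree_all[of x] inv unfolding agree_def by metis
qed

end

theorem theorem3p5: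
  fixes scale :: "complex \<Rightarrow> 'm::ab_group_add \<Rightarrow> 'm"
    and M :: "bit \<Rightarrow> 'm set"
    and act :: "hv \<Rightarrow> 'm \<Rightarrow> 'm"
  assumes "hv_module scale M act"
    and "free_of_rank (Uh_scale scale act) 2"
  shows "\<exists>(l::complex) (\<beta>::complex poly). l \<noteq> 0 \<and>
    (supermodule_iso scale M act omega_scale omega_grade (omega_act l \<beta>) \<or>
     supermodule_iso scale (parity_change M) act omega_scale omega_grade (omega_act l \<beta>))"
proof -
  interpret hv_supermodule scale M act using assms(1) by (rule hv_supermodule.intro)
  obtain u w where "rank_one_parts scale M act u w"
    using rank_one_parts_exist[OF assms(2)] .
  then interpret rank_one_parts scale M act u w .
  show ?thesis
  proof (cases rule: normal_form_up_to_parity)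
    case (even k k')
    then obtain w' l \<beta> where "normalised scale M act u w' l \<beta>" by (rule normalisation)
    then show ?thesis using normalised.iso_omega normalised.l_nonzero by blast
  next
    case (odd k k')
    then obtain w' l \<beta> where "normalised scale (parity_change M) act w w' l \<beta>"
      by (rule rank_one_parts.normalisation[OF rank_one_parts_parity_change])
    then show ?thesis using normalised.iso_omega normalised.l_nonzero by blast
  qed
qed

end
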